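(* Let $P\subseteq\mathbb{R}^d$ be a lattice $d$-polytope with $\mathbf{0}\in P^\circ$. Let $r$ be the codenominator of $P$ and let $k$ be the denominator of $\frac1rP$. Then $\operatorname{h}^*_{\mathbb{Q}}(P;t;k)$ is palindromic.
   Context: A lattice polytope is the convex hull of finitely many points of $\mathbb{Z}^d$; a $d$-polytope is a $d$-dimensional polytope in $\mathbb{R}^d$, $d\ge1$; $P^\circ$ is the interior. The denominator of a rational polytope $Q$ is the smallest positive integer $k$ such that $kQ$ is a lattice polytope. Codenominator: write a rational $d$-polytope $P$ by its irredundant halfspace description $P=\{\mathbf{x}\in\mathbb{R}^d:\mathbf{A}\mathbf{x}\le\mathbf{b}\}$ with $\mathbf{A}\in\mathbb{Z}^{n\times d}$, $\mathbf{b}\in\mathbb{Z}^n$, such that for every $i$ the greatest common divisor of $b_i$ and the entries of the $i$th row of $\mathbf{A}$ is $1$; the codenominator of $P$ is the (positive) least common multiple $r$ of the nonzero entries of $\mathbf{b}$. Put $\operatorname{ehr}_{\mathbb{Q}}(P;\lambda)=|\lambda P\cap\mathbb{Z}^d|$ and $\operatorname{Ehr}_{\mathbb{Q}}(P;t)=1+\sum_{n\in\mathbb{Z}_{>0}}\operatorname{ehr}_{\mathbb{Q}}(P;\frac nr)t^{\frac nr}$. For $m\in\mathbb{Z}_{>0}$ with $\frac mrP$ a lattice polytope, $\operatorname{h}^*_{\mathbb{Q}}(P;t;m):=(1-t^{m/r})^{d+1}\operatorname{Ehr}_{\mathbb{Q}}(P;t)$, a polynomial in $\mathbb{Z}[t^{1/r}]$.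 A polynomial $f(t)\in\mathbb{Z}[t^{1/r}]$ of (possibly fractional) degree $\delta$ in $t$ is palindromic if $t^{\delta}f(1/t)=f(t)$. *)

theory Defs
  imports "HOL-Computational_Algebra.Polynomial_FPS" "HOL-Analysis.Analysis"
begin

definition integer_points :: "(real ^ 'd) set" where
  "integer_points = {x. \<forall>i. x $ i \<in> \<int>}"

definition dilate :: "real \<Rightarrow> (real ^ 'd) set \<Rightarrow> (real ^ 'd) set" where
  "dilate c P = (\<lambda>x. c *\<^sub>R x) ` P"

definition lattice_polytope :: "(real ^ 'd) set \<Rightarrow> bool" where
  "lattice_polytope P \<longleftrightarrow>
     (\<exists>S. finite S \<and> S \<subseteq> integer_points \<and> P = convex hull S)"

definition denominator :: "(real ^ 'd) set \<Rightarrow> nat" where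
  "denominator Q = (LEAST k. 0 < k \<and> lattice_polytope (dilate (real k) Q))"

definition row_halfspace :: "int ^ 'd \<Rightarrow> int \<Rightarrow> (real ^ 'd) set" where
  "row_halfspace a \<beta> = {x. (\<Sum>j\<in>UNIV. real_of_int (a $ j) * x $ j) \<le> real_of_int \<beta>}"

(* The n x d matrix A and the right-hand side b are given by their rows A i and entries b i
   for i < n; values at indices i \<ge> n are ignored. *)
definition irredundant_description ::
  "(real ^ 'd) set \<Rightarrow> nat \<Rightarrow> (nat \<Rightarrow> int ^ 'd) \<Rightarrow> (nat \<Rightarrow> int) \<Rightarrow> bool" where
  "irredundant_description P n A b \<longleftrightarrow>
     P = (\<Inter>i\<in>{..<n}. row_halfspace (A i) (b i)) \<and>
     (\<forall>j<n. (\<Inter>i\<in>{..<n} - {j}. row_halfspace (A i) (b i)) \<noteq> P) \<and>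
     (\<forall>i<n. Gcd (insert (b i) (range (\<lambda>j. A i $ j))) = 1)"

(* For a full-dimensional rational polytope such a description exists and is unique up to
   the order of the rows, so the value below is well defined. *)
definition codenominator :: "(real ^ 'd) set \<Rightarrow> nat" where
  "codenominator P = (THE r. \<exists>n A b. irredundant_description P n A b \<and>
     r = Lcm {nat \<bar>b i\<bar> | i. i < n \<and> b i \<noteq> 0})"

definition ehr_rat :: "(real ^ 'd) set \<Rightarrow> real \<Rightarrow> nat" where
  "ehr_rat P l = card (dilate l P \<inter> integer_points)"

(* Series and polynomials in t^(1/r), with r the codenominator of P, are represented as formal
   power series and polynomials in one variable X standing for t^(1/r): the coefficient of X^n
   is that of t^(n/r), and X^m is t^(m/r). *)
definition Ehr_rat :: "(real ^ 'd) set \<Rightarrow> int fps" where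
  "Ehr_rat P = 1 + Abs_fps (\<lambda>n. if n = 0 then 0
     else int (ehr_rat P (real n / real (codenominator P))))"

definition hstar_rat :: "(real ^ 'd) set \<Rightarrow> nat \<Rightarrow> int fps" where
  "hstar_rat P m = (1 - fps_X ^ m) ^ (CARD('d) + 1) * Ehr_rat P"

(* The degree of f in t is \<delta> = degree f / r, so t^\<delta> f(1/t) is X^(degree f) f(1/X), which is
   reflect_poly f. *)
definition palindromic :: "int poly \<Rightarrow> bool" where
  "palindromic f \<longleftrightarrow> reflect_poly f = f"

end

theory Submission
  imports Defs
begin

text \<open>
  Write \<open>X = t^(1/r)\<close> and \<open>d = CARD('d)\<close>. Every facet inequality \<open>a \<bullet> x \<le> b\<close> of \<open>P\<close> has \<open>b > 0\<close>, and \<open>b\<close>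
  divides \<open>r\<close>, so \<open>g(x) = r * (gauge of P at x)\<close>, the maximum of the numbers \<open>(r/b) (a \<bullet> x)\<close>, is a
  nonnegative integer at every lattice point \<open>x\<close>. A lattice point lies in \<open>(n/r) P\<close> iff
  \<open>g(x) \<le> n\<close>, hence \<open>(1 - X) Ehr = G\<close>, where \<open>G\<close> is the sum of \<open>X^g(x)\<close> over all lattice points.

  By the choice of \<open>k\<close> the polytope \<open>(k/r) P\<close> is the convex hull of a finite set \<open>W\<close> of lattice points.
  There is a complete simplicial fan whose cones are spanned by bases \<open>B \<subseteq> W\<close> lying in facets of
  \<open>(k/r) P\<close> (lemma \<open>boundary_fan_exists\<close>). On such a cone \<open>g\<close> is linear with value \<open>k\<close> on
  \<open>B\<close> (lemma \<open>mem_scaled_hull_iff\<close>). A generic vector \<open>q\<close> decides which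
  walls belong to which cone and so partitions the space into half-open cones
  (lemma \<open>half_open_cone_partition\<close>); each of them is tiled by translates of its half-open fundamental
  parallelepiped. Therefore \<open>(1 - X^k)^d G\<close> is the sum \<open>N\<close> of \<open>X^g(x)\<close> over the lattice
  points of the parallelepipeds (lemma \<open>level_series_half_open_cone\<close>).

  The palindromicity comes from replacing \<open>q\<close> by \<open>- q\<close>. This exchanges the walls that are present with
  those that are missing, and so does the point reflection of each parallelepiped, which turns
  \<open>g(x)\<close> into \<open>k d - g(x)\<close> (lemma \<open>parallelepiped_reflection\<close>). But \<open>N = (1 - X^k)^d G\<close> does not
  depend on \<open>q\<close>. So the coefficients of \<open>N\<close> at \<open>n\<close> and at \<open>k d - n\<close> agree, and the
  polynomial in question is \<open>N (1 + X + \<dots> + X^(k-1))\<close>, a product of two palindromic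
  polynomials.

  It remains to see that \<open>r\<close> is what it should be: an irredundant primitive description of \<open>P\<close>
  exists, because the linear functions on the cones of the fan are rational, and any two have the
  same rows (lemmas \<open>irredundant_description_exists\<close> and \<open>irredundant_description_rows_subset\<close>).
\<close>

section \<open>Coordinates with respect to a basis\<close>

definition vector_basis :: "'a::euclidean_space set \<Rightarrow> bool" where
  "vector_basis B \<longleftrightarrow> independent B \<and> span B = UNIV"

text \<open>The linear functional that takes the value \<open>c b\<close> at every basis vector \<open>b\<close>.\<close>

definition interpolant :: "('a::euclidean_space \<Rightarrow> real) \<Rightarrow> 'a set \<Rightarrow> 'a \<Rightarrow> real" where
  "interpolant c B x = (\<Sum>b\<in>B. c b * representation B x b)"

definition basis_cone :: "'a::euclidean_space set \<Rightarrow> 'a set" where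
  "basis_cone B = {x. \<forall>b\<in>B. 0 \<le> representation B x b}"

definition basis_cone_interior :: "'a::euclidean_space set \<Rightarrow> 'a set" where
  "basis_cone_interior B = {x. \<forall>b\<in>B. 0 < representation B x b}"

lemma vector_basis_finite: "vector_basis B \<Longrightarrow> finite B"
  unfolding vector_basis_def by (simp add: finiteI_independent)

lemma vector_basis_card: "vector_basis (B :: 'a::euclidean_space set) \<Longrightarrow> card B = DIM('a)"
  unfolding vector_basis_def using dim_eq_card[of B UNIV] by simp

lemma representation_linear: 
  assumes "vector_basis B" shows "linear (\<lambda>x. representation B x b)"
proof (rule linearI)
  have B: "independent B" "span B = UNIV" using assms by (auto simp: vector_basis_def)
  show "representation B (x + y) b = representation B x b + representation B y b" for x y
    by (simp add: real_vector.representation_add B)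
  show "representation B (s *\<^sub>R x) b = s *\<^sub>R representation B x b" for s x
    by (simp add: real_vector.representation_scale B)
qed

lemma representation_at_basis:
  "vector_basis B \<Longrightarrow> b \<in> B \<Longrightarrow> representation B b b' = (if b' = b then 1 else 0)"
  unfolding vector_basis_def by (simp add: real_vector.representation_basis)

lemma representation_sum_eq:
  assumes "vector_basis B"
  shows "(\<Sum>b\<in>B. representation B x b *\<^sub>R b) = x"
  using assms vector_basis_finite[OF assms] real_vector.sum_representation_eq[of B x B]
  unfolding vector_basis_def by simp

lemma interpolant_linear:
  assumes "vector_basis B"
  shows "linear (interpolant c B)"
proof (rule linearI)
  note lin = representation_linear[OF assms]
  show "interpolant c B (x + y) = interpolant c B x + interpolant c B y" for x y
    unfolding interpolant_def by (simp add: linear_add[OF lin] algebra_simps sum.distrib)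
  show "interpolant c B (s *\<^sub>R x) = s *\<^sub>R interpolant c B x" for s x
    unfolding interpolant_def by (simp add: linear_cmul[OF lin] algebra_simps sum_distrib_left)
qed

lemma interpolant_at_basis:
  assumes "vector_basis B" "b \<in> B"
  shows "interpolant c B b = c b"
proof -
  have "interpolant c B b = (\<Sum>b'\<in>B. if b' = b then c b' else 0)"
    unfolding interpolant_def
    by (rule sum.cong) (auto simp: representation_at_basis[OF assms])
  then show ?thesis using assms(2) vector_basis_finite[OF assms(1)] by simp
qed

lemma interpolant_unique:
  assumes "vector_basis B" "linear f" "\<And>b. b \<in> B \<Longrightarrow> f b = c b"
  shows "f x = interpolant c B x"
proof -
  have "f x = f (\<Sum>b\<in>B. representation B x b *\<^sub>R b)"
    using representation_sum_eq[OF assms(1)] by simp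
  also have "\<dots> = (\<Sum>b\<in>B. representation B x b * f b)"
    by (simp add: linear_sum[OF assms(2)] linear_cmul[OF assms(2)])
  also have "\<dots> = interpolant c B x"
    unfolding interpolant_def by (rule sum.cong) (auto simp: assms(3))
  finally show ?thesis .
qed

lemma linear_functional_as_inner:
  fixes f :: "'a::euclidean_space \<Rightarrow> real"
  assumes "linear f"
  obtains z where "\<And>x. f x = z \<bullet> x"
proof
  fix x
  have "f x = f (\<Sum>e\<in>Basis. (x \<bullet> e) *\<^sub>R e)" by (simp add: euclidean_representation)
  also have "\<dots> = (\<Sum>e\<in>Basis. (x \<bullet> e) * f e)"
    by (simp add: linear_sum[OF assms] linear_cmul[OF assms])
  also have "\<dots> = (\<Sum>e\<in>Basis. f e *\<^sub>R e) \<bullet> x"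
    unfolding inner_sum_left by (rule sum.cong) (auto simp: inner_commute)
  finally show "f x = (\<Sum>e\<in>Basis. f e *\<^sub>R e) \<bullet> x" .
qed

section \<open>A simplicial fan over the boundary of a polytope\<close>

text \<open>For positive heights \<open>c\<close>, the simplex with vertices \<open>b / c b\<close> for \<open>b \<in> B\<close> is then a face of the
  convex hull of all points \<open>w / c w\<close>. Dually, the interpolant is a vertex of the polyhedron of all
  functionals bounded by \<open>c\<close> on \<open>W\<close>, and its tight constraints are exactly those of \<open>B\<close>.\<close>

definition facet_basis :: "('a::euclidean_space \<Rightarrow> real) \<Rightarrow> 'a set \<Rightarrow> 'a set \<Rightarrow> bool" where
  "facet_basis c W B \<longleftrightarrow>
     vector_basis B \<and> B \<subseteq> W \<and> (\<forall>u\<in>W - B. interpolant c B u < c u)"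

lemma common_small_factor:
  assumes "finite A" "\<And>u. u \<in> A \<Longrightarrow> (0::real) < s u"
  obtains \<delta> where "0 < \<delta>" "\<And>u. u \<in> A \<Longrightarrow> \<delta> * \<bar>a u\<bar> \<le> s u"
proof -
  have "\<forall>\<^sub>F \<delta> in at_right 0. \<forall>u\<in>A. \<delta> * \<bar>a u\<bar> < s u"
  proof (intro eventually_ball_finite ballI assms(1))
    fix u assume "u \<in> A"
    have "((\<lambda>\<delta>. \<delta> * \<bar>a u\<bar>) \<longlongrightarrow> 0 * \<bar>a u\<bar>) (at_right 0)"
      by (intro tendsto_intros)
    then show "\<forall>\<^sub>F \<delta> in at_right 0. \<delta> * \<bar>a u\<bar> < s u"
      using assms(2)[OF \<open>u \<in> A\<close>] by (auto dest: order_tendstoD)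
  qed
  then have "\<forall>\<^sub>F \<delta> in at_right (0::real). 0 < \<delta> \<and> (\<forall>u\<in>A. \<delta> * \<bar>a u\<bar> < s u)"
    using eventually_at_right_less[of "0::real"] by eventually_elim auto
  then obtain \<delta> where "0 < \<delta>" "\<forall>u\<in>A. \<delta> * \<bar>a u\<bar> < s u"
    by (metis (mono_tags, lifting) eventually_happens' trivial_limit_at_right_real)
  then show ?thesis using that by (meson less_imp_le)
qed

text \<open>If \<open>x\<close> is interior to both cones, then evaluating either interpolant at \<open>x\<close> with the
  positive coordinates of the other basis shows that the two values agree, and equality forces
  each basis to be tight for the other interpolant.\<close>

lemma facet_basis_unique:
  assumes B: "facet_basis c W B" and B': "facet_basis c W B'"
    and x: "x \<in> basis_cone_interior B" "x \<in> basis_cone_interior B'"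
  shows "B = B'"
proof -
  have le: "interpolant c B2 x \<le> interpolant c B1 x \<and>
            (interpolant c B2 x = interpolant c B1 x \<longrightarrow> B1 \<subseteq> B2)"
    if B1: "facet_basis c W B1" and B2: "facet_basis c W B2" and x1: "x \<in> basis_cone_interior B1"
    for B1 B2
  proof -
    have vb: "vector_basis B1" "vector_basis B2" using B1 B2 by (auto simp: facet_basis_def)
    have fin: "finite B1" using vb vector_basis_finite by blast
    note lin = interpolant_linear[OF vb(2), of c]
    have "interpolant c B2 x = interpolant c B2 (\<Sum>b\<in>B1. representation B1 x b *\<^sub>R b)"
      using representation_sum_eq[OF vb(1)] by simp
    also have "\<dots> = (\<Sum>b\<in>B1. interpolant c B2 b * representation B1 x b)"
      by (simp add: linear_sum[OF lin] linear_cmul[OF lin] mult.commute)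
    finally have val: "interpolant c B2 x = (\<Sum>b\<in>B1. interpolant c B2 b * representation B1 x b)" .
    have bd: "interpolant c B2 b \<le> c b" if "b \<in> B1" for b
    proof (cases "b \<in> B2")
      case False
      then have "b \<in> W - B2" using B1 that by (auto simp: facet_basis_def)
      then show ?thesis using B2 by (auto simp: facet_basis_def less_imp_le)
    qed (simp add: interpolant_at_basis[OF vb(2)])
    have pos: "0 < representation B1 x b" if "b \<in> B1" for b
      using x1 that by (auto simp: basis_cone_interior_def)
    have le: "interpolant c B2 x \<le> interpolant c B1 x"
      unfolding val interpolant_def[of c B1]
      using bd pos by (intro sum_mono mult_right_mono) (auto simp: less_imp_le)
    moreover have "B1 \<subseteq> B2" if eq: "interpolant c B2 x = interpolant c B1 x"
    proof
      fix b assume b: "b \<in> B1"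
      show "b \<in> B2"
      proof (rule ccontr)
        assume "b \<notin> B2"
        then have "interpolant c B2 b < c b" using B1 B2 b by (auto simp: facet_basis_def)
        then have "interpolant c B2 x < interpolant c B1 x"
          unfolding val interpolant_def[of c B1]
          using bd pos b mult_strict_right_mono[OF _ pos[OF b]]
          by (intro sum_strict_mono_ex1[OF fin] ballI bexI[of _ b] mult_right_mono)
            (auto simp: less_imp_le)
        then show False using eq by simp
      qed
    qed
    ultimately show ?thesis by blast
  qed
  have "interpolant c B' x = interpolant c B x"
    using le[OF B B' x(1)] le[OF B' B x(2)] by linarith
  then show ?thesis using le[OF B B' x(1)] le[OF B' B x(2)] by (simp add: subset_antisym)
qed

lemma in_open_segment_symmetric:
  fixes v :: "'a::real_vector"
  assumes "v \<noteq> 0"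
  shows "y \<in> open_segment (y + v) (y - v)"
proof -
  have "2 *\<^sub>R v = (y + v) - (y - v)" by (simp add: scaleR_2)
  then have "y + v \<noteq> y - v"
    using assms by (metis diff_self scaleR_eq_0_iff zero_neq_numeral)
  moreover have "y = (1 - 1 / 2) *\<^sub>R (y + v) + (1 / 2) *\<^sub>R (y - v)"
    by (simp add: scaleR_add_right scaleR_diff_right flip: scaleR_add_left)
  ultimately show ?thesis unfolding in_segment
    by (intro conjI exI[of _ "1 / 2"]) simp_all
qed

text \<open>Linear programming: maximise \<open>x\<close> over the polyhedron of functionals bounded by \<open>c\<close> on \<open>W\<close>.
  A maximum is attained at a vertex, whose tight constraints form a basis because \<open>c\<close> is generic,
  and a negative coordinate of \<open>x\<close> in that basis would give a direction in which the objective
  still increases.\<close>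

lemma facet_basis_cover:
  fixes W :: "'a::euclidean_space set"
  assumes fin: "finite W" and int: "0 \<in> interior (convex hull W)"
    and pos: "\<And>w. w \<in> W \<Longrightarrow> 0 < c w"
    and generic: "\<And>B u. vector_basis B \<Longrightarrow> B \<subseteq> W \<Longrightarrow> u \<in> W - B \<Longrightarrow> interpolant c B u \<noteq> c u"
  obtains B where "facet_basis c W B" "x \<in> basis_cone B"
proof -
  define D where "D = {y. \<forall>w\<in>W. y \<bullet> w \<le> c w}"
  have D_eq: "D = (\<Inter>w\<in>W. {y. w \<bullet> y \<le> c w})" by (auto simp: D_def inner_commute)
  have "closed D" "convex D"
    unfolding D_eq by (auto intro!: closed_INT closed_halfspace_le convex_INT convex_halfspace_le)
  have "bounded D"
  proof -
    obtain e where e: "0 < e" "cball 0 e \<subseteq> convex hull W"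
      using int mem_interior_cball by blast
    define m where "m = (\<Sum>w\<in>W. c w)"
    have cm: "c w \<le> m" if "w \<in> W" for w
      unfolding m_def using fin that pos by (intro member_le_sum) (auto simp: less_imp_le)
    have "norm y \<le> m / e" if y: "y \<in> D" for y
    proof -
      have "W \<subseteq> {v. y \<bullet> v \<le> m}" using y cm by (fastforce simp: D_def)
      then have "convex hull W \<subseteq> {v. y \<bullet> v \<le> m}"
        by (rule hull_minimal) (rule convex_halfspace_le)
      moreover have "(e / norm y) *\<^sub>R y \<in> cball 0 e" using e by simp
      ultimately have "y \<bullet> ((e / norm y) *\<^sub>R y) \<le> m" using e by blast
      then show ?thesis using e
        by (simp add: dot_square_norm power2_eq_square pos_le_divide_eq mult.commute split: if_splits)
    qed
    then show ?thesis by (auto simp: bounded_iff)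
  qed
  then have "compact D" using \<open>closed D\<close> by (simp add: compact_eq_bounded_closed)
  have "D \<noteq> {}" using pos by (auto simp: D_def less_imp_le intro!: exI[of _ 0])
  obtain y0 where y0: "y0 \<in> D" "\<And>y. y \<in> D \<Longrightarrow> x \<bullet> y \<le> x \<bullet> y0"
    using continuous_attains_sup[OF \<open>compact D\<close> \<open>D \<noteq> {}\<close>, of "\<lambda>y. x \<bullet> y"]
      continuous_on_inner[OF continuous_on_const continuous_on_id] by blast
  \<comment> \<open>An extreme point of the optimal face \<open>F\<close> has tight constraints that span the whole space:
    otherwise it could be moved in both directions orthogonal to them without leaving \<open>F\<close>.\<close>
  define F where "F = D \<inter> {y. x \<bullet> y = x \<bullet> y0}"
  have "compact F" "convex F" "F \<noteq> {}"
    unfolding F_def using \<open>compact D\<close> \<open>convex D\<close> y0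
    by (auto intro!: compact_Int_closed closed_hyperplane convex_Int convex_hyperplane)
  then obtain y where yF: "y extreme_point_of F" using extreme_point_exists_convex by blast
  then have y: "y \<in> D" and xy: "x \<bullet> y = x \<bullet> y0"
    by (auto simp: extreme_point_of_def F_def)
  define T where "T = {w\<in>W. y \<bullet> w = c w}"
  have slack: "0 < c u - y \<bullet> u" if "u \<in> W - T" for u
    using y that by (force simp: D_def T_def)
  have spanT: "span T = UNIV"
  proof (rule ccontr)
    assume "span T \<noteq> UNIV"
    from span_not_UNIV_orthogonal[OF this] obtain z
      where z: "z \<noteq> 0" "\<And>w. w \<in> T \<Longrightarrow> z \<bullet> w = 0"
      by (auto intro: span_base)
    obtain \<delta> where \<delta>: "0 < \<delta>" "\<And>u. u \<in> W - T \<Longrightarrow> \<delta> * \<bar>z \<bullet> u\<bar> \<le> c u - y \<bullet> u"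
      by (rule common_small_factor[of "W - T" "\<lambda>u. c u - y \<bullet> u" "\<lambda>u. z \<bullet> u"])
        (use fin slack in auto)
    have mem: "y + s *\<^sub>R z \<in> D" if s: "\<bar>s\<bar> = \<delta>" for s
      unfolding D_def
    proof (intro CollectI ballI)
      fix w assume w: "w \<in> W"
      show "(y + s *\<^sub>R z) \<bullet> w \<le> c w"
      proof (cases "w \<in> T")
        case True
        then show ?thesis using z(2) by (simp add: inner_add_left T_def)
      next
        case False
        have "s * (z \<bullet> w) \<le> \<delta> * \<bar>z \<bullet> w\<bar>"
          using abs_ge_self[of "s * (z \<bullet> w)"] by (simp add: abs_mult s)
        then show ?thesis using \<delta>(2)[of w] False w by (simp add: inner_add_left)
      qed
    qed
    have "x \<bullet> z = 0"
    proof -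
      have "\<delta> * (x \<bullet> z) \<le> 0" "0 \<le> \<delta> * (x \<bullet> z)"
        using y0(2)[OF mem[of \<delta>]] y0(2)[OF mem[of "-\<delta>"]] \<delta>(1) xy
        by (simp_all add: inner_add_right inner_diff_right)
      then have "\<delta> * (x \<bullet> z) = 0" by linarith
      then show ?thesis using \<delta>(1) by simp
    qed
    then have "y + \<delta> *\<^sub>R z \<in> F" "y - \<delta> *\<^sub>R z \<in> F"
      using mem[of \<delta>] mem[of "-\<delta>"] \<delta>(1) xy by (auto simp: F_def inner_add_right inner_diff_right)
    moreover have "y \<in> open_segment (y + \<delta> *\<^sub>R z) (y - \<delta> *\<^sub>R z)"
      using z(1) \<delta>(1) by (intro in_open_segment_symmetric) simp
    ultimately show False using yF by (auto simp: extreme_point_of_def)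
  qed
  obtain B where B: "B \<subseteq> T" "independent B" "T \<subseteq> span B"
    using real_vector.maximal_independent_subset by blast
  have vb: "vector_basis B"
    using B(2) spanT span_minimal[OF B(3) subspace_span] by (auto simp: vector_basis_def)
  have BW: "B \<subseteq> W" using B(1) by (auto simp: T_def)
  have y_eq: "y \<bullet> u = interpolant c B u" for u
    by (rule interpolant_unique[OF vb]) (use B(1) in \<open>auto simp: T_def bounded_linear.linear bounded_linear_inner_right\<close>)
  have TB: "T = B"
  proof (rule ccontr)
    assume "T \<noteq> B"
    then obtain u where u: "u \<in> T" "u \<notin> B" using B(1) by blast
    then have "interpolant c B u = c u" "u \<in> W - B" using y_eq by (auto simp: T_def)
    then show False using generic[OF vb BW] by blast
  qed
  have "facet_basis c W B"
    unfolding facet_basis_def using vb BW slack TB by (auto simp: y_eq)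
  moreover have "x \<in> basis_cone B"
  proof (rule ccontr)
    assume "x \<notin> basis_cone B"
    then obtain b where b: "b \<in> B" "representation B x b < 0"
      by (auto simp: basis_cone_def not_le)
    obtain z where z: "\<And>v. representation B v b = z \<bullet> v"
      using linear_functional_as_inner[OF representation_linear[OF vb]] by blast
    obtain \<delta> where \<delta>: "0 < \<delta>" "\<And>u. u \<in> W - T \<Longrightarrow> \<delta> * \<bar>z \<bullet> u\<bar> \<le> c u - y \<bullet> u"
      by (rule common_small_factor[of "W - T" "\<lambda>u. c u - y \<bullet> u" "\<lambda>u. z \<bullet> u"])
        (use fin slack in auto)
    have "y - \<delta> *\<^sub>R z \<in> D"
      unfolding D_def
    proof (intro CollectI ballI)
      fix w assume w: "w \<in> W"
      show "(y - \<delta> *\<^sub>R z) \<bullet> w \<le> c w"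
      proof (cases "w \<in> T")
        case True
        then have "0 \<le> z \<bullet> w"
          using representation_at_basis[OF vb, of w b] z TB by (metis order_refl zero_le_one)
        then show ?thesis using True \<delta>(1) by (simp add: inner_diff_left T_def)
      next
        case False
        have "- (\<delta> * (z \<bullet> w)) \<le> \<delta> * \<bar>z \<bullet> w\<bar>"
          using \<delta>(1) by (simp add: abs_if)
        then show ?thesis using \<delta>(2)[of w] False w by (simp add: inner_diff_left)
      qed
    qed
    then have "x \<bullet> (y - \<delta> *\<^sub>R z) \<le> x \<bullet> y" using y0(2) xy by simp
    then have "0 \<le> \<delta> * (z \<bullet> x)" by (simp add: inner_diff_right inner_commute)
    then show False using b(2) z \<delta>(1) by (simp add: zero_le_mult_iff)
  qed
  ultimately show ?thesis using that by blast
qed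

text \<open>Take the heights \<open>1 + t ^ j w\<close> with distinct positive exponents \<open>j w\<close>. A coincidence of \<open>c u\<close>
  with the value interpolated from other points is a polynomial equation in \<open>t\<close> in which \<open>t ^ j u\<close> has
  coefficient \<open>1\<close>, so small positive \<open>t\<close> avoid all coincidences. They also preserve the strict
  inequalities that hold at \<open>t = 0\<close>, that is, for constant height; hence a facet basis for \<open>c\<close> still
  lies on a supporting hyperplane of the convex hull of \<open>W\<close> itself.\<close>

lemma generic_heights:
  fixes W :: "'a::euclidean_space set"
  assumes fin: "finite W"
  obtains c where "\<And>w. w \<in> W \<Longrightarrow> 0 < c w"
    "\<And>B u. vector_basis B \<Longrightarrow> B \<subseteq> W \<Longrightarrow> u \<in> W - B \<Longrightarrow> interpolant c B u \<noteq> c u"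
    "\<And>B u. vector_basis B \<Longrightarrow> B \<subseteq> W \<Longrightarrow> u \<in> W - B \<Longrightarrow> interpolant c B u < c u
       \<Longrightarrow> interpolant (\<lambda>_. 1) B u \<le> 1"
proof -
  obtain j0 :: "'a \<Rightarrow> nat" where j0: "inj_on j0 W"
    using finite_imp_inj_to_nat_seg[OF fin] by metis
  define j where "j = (\<lambda>w. Suc (j0 w))"
  have j: "inj_on j W" using j0 by (auto simp: inj_on_def j_def)
  define c where "c = (\<lambda>(t::real) w. 1 + t ^ j w)"
  define p where "p = (\<lambda>B u. 1 + monom (1::real) (j u)
      - (\<Sum>b\<in>B. smult (representation B u b) (1 + monom 1 (j b))))"
  have p_eval: "poly (p B u) t = c t u - interpolant (c t) B u" for B u t
    by (simp add: p_def c_def interpolant_def poly_sum poly_monom mult.commute)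
  have c0: "c 0 = (\<lambda>_. 1)" by (auto simp: c_def j_def)
  have p_nz: "p B u \<noteq> 0" if B: "B \<subseteq> W" "u \<in> W - B" for B u
  proof -
    have neq: "j b \<noteq> j u" if "b \<in> B" for b using j B that by (auto simp: inj_on_def)
    have "coeff (p B u) (j u) = 1"
      using neq by (auto simp: p_def coeff_sum j_def one_pCons coeff_pCons)
    then show ?thesis by auto
  qed
  define good where "good = (\<lambda>t B u. poly (p B u) t \<noteq> 0 \<and> (poly (p B u) 0 < 0 \<longrightarrow> poly (p B u) t < 0))"
  have ev: "\<forall>\<^sub>F t in at_right 0. good t B u" if B: "B \<subseteq> W" "u \<in> W - B" for B u
  proof -
    have fin_roots: "finite {t. poly (p B u) t = 0}" using p_nz[OF B] by (rule poly_roots_finite)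
    have "open (- ({t. poly (p B u) t = 0} - {0}))"
      by (intro open_Compl finite_imp_closed finite_Diff fin_roots)
    then have "\<forall>\<^sub>F t in nhds 0. t \<in> - ({t. poly (p B u) t = 0} - {0})"
      by (rule eventually_nhds_in_open) simp
    then have "\<forall>\<^sub>F t in at 0. poly (p B u) t \<noteq> 0"
      unfolding eventually_at_filter by eventually_elim auto
    moreover have "\<forall>\<^sub>F t in at 0. poly (p B u) 0 < 0 \<longrightarrow> poly (p B u) t < 0"
    proof (cases "poly (p B u) 0 < 0")
      case True
      have "((\<lambda>t. poly (p B u) t) \<longlongrightarrow> poly (p B u) 0) (at 0)"
        using poly_isCont[where p = "p B u" and x = 0] by (simp add: isCont_def)
      then show ?thesis using True by (auto dest: order_tendstoD)
    qed simp
    ultimately show ?thesis unfolding good_def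
      by (auto simp: eventually_conj_iff eventually_at_split)
  qed
  have "\<forall>\<^sub>F t in at_right 0. \<forall>B\<in>Pow W. \<forall>u\<in>W - B. good t B u"
    using fin ev by (intro eventually_ball_finite ballI) auto
  then have "\<forall>\<^sub>F t in at_right 0. 0 < t \<and> (\<forall>B\<in>Pow W. \<forall>u\<in>W - B. good t B u)"
    using eventually_at_right_less[of "0::real"] by eventually_elim auto
  then obtain t where t: "0 < t" "\<forall>B\<in>Pow W. \<forall>u\<in>W - B. good t B u"
    by (metis (mono_tags, lifting) eventually_happens' trivial_limit_at_right_real)
  show ?thesis
  proof (rule that[of "c t"])
    show "0 < c t w" for w using t(1) by (simp add: c_def add_pos_pos)
    have g: "good t B u" if "B \<subseteq> W" "u \<in> W - B" for B u
      using t(2) that by blast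
    show "interpolant (c t) B u \<noteq> c t u" if "B \<subseteq> W" "u \<in> W - B" for B u
      using g[OF that] by (simp add: good_def p_eval)
    show "interpolant (\<lambda>_. 1) B u \<le> 1" if "B \<subseteq> W" "u \<in> W - B" "interpolant (c t) B u < c t u" for B u
      using g[OF that(1,2)] that(3) by (simp add: good_def p_eval c0)
  qed
qed

text \<open>The bound \<open>1\<close> on \<open>W\<close> puts \<open>B\<close> on a supporting hyperplane of the convex hull of \<open>W\<close>: the fan
  refines the fan of cones over the faces of this polytope.\<close>

definition boundary_fan :: "'a::euclidean_space set \<Rightarrow> 'a set set \<Rightarrow> bool" where
  "boundary_fan W F \<longleftrightarrow> finite F \<and>
     (\<forall>B\<in>F. vector_basis B \<and> B \<subseteq> W \<and> (\<forall>u\<in>W. interpolant (\<lambda>_. 1) B u \<le> 1)) \<and>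
     (\<forall>x. \<exists>B\<in>F. x \<in> basis_cone B) \<and>
     (\<forall>B\<in>F. \<forall>B'\<in>F. basis_cone_interior B \<inter> basis_cone_interior B' \<noteq> {} \<longrightarrow> B = B')"

lemma boundary_fan_exists:
  fixes W :: "'a::euclidean_space set"
  assumes fin: "finite W" and int: "0 \<in> interior (convex hull W)"
  obtains F where "boundary_fan W F"
proof -
  obtain c where pos: "\<And>w. w \<in> W \<Longrightarrow> 0 < c w"
    and gen: "\<And>B u. vector_basis B \<Longrightarrow> B \<subseteq> W \<Longrightarrow> u \<in> W - B \<Longrightarrow> interpolant c B u \<noteq> c u"
    and lim: "\<And>B u. vector_basis B \<Longrightarrow> B \<subseteq> W \<Longrightarrow> u \<in> W - B \<Longrightarrow> interpolant c B u < c u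
       \<Longrightarrow> interpolant (\<lambda>_. 1) B u \<le> 1"
    using generic_heights[OF fin] by metis
  define F where "F = {B. facet_basis c W B}"
  have "F \<subseteq> Pow W" by (auto simp: F_def facet_basis_def)
  then have "finite F" using fin by (simp add: finite_subset)
  moreover have "\<forall>x. \<exists>B\<in>F. x \<in> basis_cone B"
  proof
    fix x
    obtain B where "facet_basis c W B" "x \<in> basis_cone B"
      by (rule facet_basis_cover[OF fin int pos gen, of x])
    then show "\<exists>B\<in>F. x \<in> basis_cone B" by (auto simp: F_def)
  qed
  moreover have "vector_basis B \<and> B \<subseteq> W \<and> (\<forall>u\<in>W. interpolant (\<lambda>_. 1) B u \<le> 1)" if "B \<in> F" for B
  proof (intro conjI ballI)
    show vb: "vector_basis B" and BW: "B \<subseteq> W" using that by (auto simp: F_def facet_basis_def)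
    show "interpolant (\<lambda>_. 1) B u \<le> 1" if u: "u \<in> W" for u
    proof (cases "u \<in> B")
      case False
      then show ?thesis
        using lim[OF vb BW, of u] u \<open>B \<in> F\<close> by (auto simp: F_def facet_basis_def)
    qed (simp add: interpolant_at_basis[OF vb])
  qed
  moreover have "\<forall>B\<in>F. \<forall>B'\<in>F. basis_cone_interior B \<inter> basis_cone_interior B' \<noteq> {} \<longrightarrow> B = B'"
    using facet_basis_unique by (fastforce simp: F_def)
  ultimately have "boundary_fan W F" by (simp add: boundary_fan_def)
  then show ?thesis by (rule that)
qed

lemma boundary_fanD:
  assumes "boundary_fan W F" "B \<in> F"
  shows "vector_basis B" "B \<subseteq> W" "\<And>u. u \<in> W \<Longrightarrow> interpolant (\<lambda>_. 1) B u \<le> 1"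
  using assms by (auto simp: boundary_fan_def)

lemma fan_interpolant_le_one:
  assumes fan: "boundary_fan W F" "B \<in> F" and v: "v \<in> convex hull W"
  shows "interpolant (\<lambda>_. 1) B v \<le> 1"
proof -
  obtain z where z: "\<And>v. interpolant (\<lambda>_. 1) B v = z \<bullet> v"
    using linear_functional_as_inner[OF interpolant_linear[OF boundary_fanD(1)[OF fan]]] by blast
  have "W \<subseteq> {v. z \<bullet> v \<le> 1}" using boundary_fanD(3)[OF fan] by (auto simp: z)
  then have "convex hull W \<subseteq> {v. z \<bullet> v \<le> 1}" by (rule hull_minimal) (rule convex_halfspace_le)
  then show ?thesis using v by (auto simp: z)
qed

text \<open>The linear functional with value \<open>1\<close> on \<open>B\<close> is at most \<open>1\<close> on the polytope, so no smaller dilate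
  can contain a nonnegative combination \<open>x\<close> of \<open>B\<close>: on the cone over \<open>B\<close>, the sum of the
  coordinates is the gauge function of the polytope.\<close>

lemma mem_scaled_hull_iff:
  fixes W :: "'a::euclidean_space set"
  assumes fan: "boundary_fan W F" "B \<in> F" and zero: "0 \<in> convex hull W"
    and x: "x \<in> basis_cone B" and s: "0 \<le> s"
  shows "x \<in> (\<lambda>v. s *\<^sub>R v) ` (convex hull W) \<longleftrightarrow> interpolant (\<lambda>_. 1) B x \<le> s"
proof
  note vb = boundary_fanD(1)[OF fan] and BW = boundary_fanD(2)[OF fan]
  note lin = interpolant_linear[OF vb, of "\<lambda>_. 1"]
  have fin: "finite B" by (rule vector_basis_finite[OF vb])
  {
    assume "x \<in> (\<lambda>v. s *\<^sub>R v) ` (convex hull W)"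
    then obtain v where v: "v \<in> convex hull W" "x = s *\<^sub>R v" by blast
    then show "interpolant (\<lambda>_. 1) B x \<le> s"
      using s fan_interpolant_le_one[OF fan v(1)] by (simp add: linear_cmul[OF lin] mult_left_le)
  next
    assume le: "interpolant (\<lambda>_. 1) B x \<le> s"
    define a where "a = interpolant (\<lambda>_. 1) B x"
    have nn: "0 \<le> representation B x b" if "b \<in> B" for b using x that by (auto simp: basis_cone_def)
    have a: "a = (\<Sum>b\<in>B. representation B x b)" by (simp add: a_def interpolant_def)
    have a0: "0 \<le> a" unfolding a by (rule sum_nonneg) (rule nn)
    show "x \<in> (\<lambda>v. s *\<^sub>R v) ` (convex hull W)"
    proof (cases "a = 0")
      case True
      then have "\<forall>b\<in>B. representation B x b = 0"
        using sum_nonneg_eq_0_iff[OF fin nn] a by simp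
      then have "x = 0" using representation_sum_eq[OF vb, of x] by simp
      then show ?thesis using zero by (intro image_eqI[of _ _ 0]) auto
    next
      case False
      have s0: "0 < s" using False a0 le by (simp add: a_def)
      define y where "y = (\<Sum>b\<in>B. (representation B x b / a) *\<^sub>R b)"
      have "y \<in> convex hull W"
        unfolding y_def
      proof (rule convex_sum[OF fin convex_convex_hull])
        show "(\<Sum>b\<in>B. representation B x b / a) = 1"
          using False by (simp add: a flip: sum_divide_distrib)
      qed (use nn a0 BW hull_subset[of W convex] in auto)
      then have "(a / s) *\<^sub>R y + (1 - a / s) *\<^sub>R 0 \<in> convex hull W"
        using zero s0 le a0 by (intro convexD[OF convex_convex_hull]) (auto simp: a_def)
      moreover have "a *\<^sub>R y = x"
        using False representation_sum_eq[OF vb, of x] by (simp add: y_def scaleR_sum_right)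
      then have "x = s *\<^sub>R ((a / s) *\<^sub>R y + (1 - a / s) *\<^sub>R 0)" using s0 by simp
      ultimately show ?thesis by blast
    qed
  }
qed

section \<open>Half-open cones\<close>

definition generic_direction :: "'a::euclidean_space set \<Rightarrow> 'a \<Rightarrow> bool" where
  "generic_direction W q \<longleftrightarrow> (\<forall>B\<subseteq>W. vector_basis B \<longrightarrow> (\<forall>b\<in>B. representation B q b \<noteq> 0))"

text \<open>If no coordinate of \<open>q\<close> vanishes, these are the points that every sufficiently small step in
  direction \<open>q\<close> moves into the interior of the cone.\<close>

definition half_open_cone :: "'a::euclidean_space \<Rightarrow> 'a set \<Rightarrow> 'a set" where
  "half_open_cone q B =
     {x. \<forall>b\<in>B. 0 \<le> representation B x b \<and> (representation B q b < 0 \<longrightarrow> 0 < representation B x b)}"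

lemma generic_direction_exists:
  fixes W :: "'a::euclidean_space set"
  assumes "finite W"
  obtains q where "generic_direction W q"
proof -
  define H where "H = (\<lambda>(B, b). {q::'a. representation B q b = 0})"
  define I where "I = (SIGMA B:{B. B \<subseteq> W \<and> vector_basis B}. B)"
  have "finite I" unfolding I_def using assms
    by (intro finite_SigmaI) (auto simp: vector_basis_finite)
  have "negligible (H p)" if pI: "p \<in> I" for p
  proof -
    obtain B b where p: "p = (B, b)" "vector_basis B" "b \<in> B" using pI by (auto simp: I_def)
    obtain z where z: "\<And>v. representation B v b = z \<bullet> v"
      using linear_functional_as_inner[OF representation_linear[OF p(2)]] by blast
    have "z \<noteq> 0" using z[of b] representation_at_basis[OF p(2,3), of b] by auto
    then show ?thesis using negligible_hyperplane[of z 0] by (simp add: H_def p z)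
  qed
  then have "negligible (\<Union>(H ` I))"
    using \<open>finite I\<close> by (intro negligible_Union) auto
  then have "\<Union>(H ` I) \<noteq> UNIV" using non_negligible_UNIV by auto
  then obtain q where "q \<notin> \<Union>(H ` I)" by blast
  then have "generic_direction W q" by (auto simp: generic_direction_def H_def I_def)
  then show ?thesis by (rule that)
qed

lemma generic_direction_uminus: "generic_direction W q \<Longrightarrow> generic_direction W (- q)"
  unfolding generic_direction_def by (simp add: linear_neg[OF representation_linear])

text \<open>A point \<open>x\<close> lies in exactly one half-open cone, because \<open>x + \<epsilon> q\<close> lies in the interior of
  exactly one cone for small positive \<open>\<epsilon>\<close>.\<close>

lemma half_open_cone_partition:
  fixes W :: "'a::euclidean_space set"
  assumes fan: "boundary_fan W F" and q: "generic_direction W q"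
  shows "\<exists>!B. B \<in> F \<and> x \<in> half_open_cone q B"
proof -
  have rep: "representation B (x + \<epsilon> *\<^sub>R q) b = representation B x b + \<epsilon> * representation B q b"
    if "B \<in> F" for B b \<epsilon>
    using representation_linear[OF boundary_fanD(1)[OF fan that], of b]
      linear_add[of "\<lambda>x. representation B x b"] linear_cmul[of "\<lambda>x. representation B x b"]
    by simp
  have to_rep: "((\<lambda>\<epsilon>. representation B x b + \<epsilon> * representation B q b) \<longlongrightarrow> representation B x b)
      (at_right 0)" for B b
    by (rule tendsto_eq_intros refl | simp)+
  show ?thesis
  proof (rule ex_ex1I)
    show "\<exists>B. B \<in> F \<and> x \<in> half_open_cone q B"
    proof (rule ccontr)
      assume none: "\<nexists>B. B \<in> F \<and> x \<in> half_open_cone q B"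
      have "\<forall>\<^sub>F \<epsilon> in at_right 0. \<forall>B\<in>F. x + \<epsilon> *\<^sub>R q \<notin> basis_cone B"
      proof (intro eventually_ball_finite ballI)
        show "finite F" using fan by (simp add: boundary_fan_def)
        fix B assume B: "B \<in> F"
        then have "x \<notin> half_open_cone q B" using none by blast
        then obtain b where b: "b \<in> B" and
          "representation B x b < 0 \<or> representation B x b \<le> 0 \<and> representation B q b < 0"
          by (auto simp: half_open_cone_def not_le not_less)
        then have "\<forall>\<^sub>F \<epsilon> in at_right 0. representation B x b + \<epsilon> * representation B q b < 0"
        proof (elim disjE conjE)
          assume "representation B x b < 0"
          then show ?thesis by (rule order_tendstoD(2)[OF to_rep])
        next
          assume *: "representation B x b \<le> 0" "representation B q b < 0"
          show ?thesis using eventually_at_right_less[of "0::real"]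
            by eventually_elim (use * in \<open>auto intro: add_nonpos_neg mult_pos_neg\<close>)
        qed
        then show "\<forall>\<^sub>F \<epsilon> in at_right 0. x + \<epsilon> *\<^sub>R q \<notin> basis_cone B"
          by eventually_elim (use b in \<open>auto simp: basis_cone_def rep[OF B] not_le\<close>)
      qed
      then obtain \<epsilon> where "\<forall>B\<in>F. x + \<epsilon> *\<^sub>R q \<notin> basis_cone B"
        using eventually_happens'[OF trivial_limit_at_right_real] by blast
      then show False using fan by (auto simp: boundary_fan_def)
    qed
  next
    fix B B'
    assume B: "B \<in> F \<and> x \<in> half_open_cone q B" and B': "B' \<in> F \<and> x \<in> half_open_cone q B'"
    have ev: "\<forall>\<^sub>F \<epsilon> in at_right 0. x + \<epsilon> *\<^sub>R q \<in> basis_cone_interior C"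
      if C: "C \<in> F" "x \<in> half_open_cone q C" for C
    proof -
      have lin: "linear (\<lambda>x. representation C x b)" for b
        by (rule representation_linear[OF boundary_fanD(1)[OF fan C(1)]])
      have "\<forall>\<^sub>F \<epsilon> in at_right 0. \<forall>b\<in>C. 0 < representation C x b + \<epsilon> * representation C q b"
      proof (intro eventually_ball_finite ballI)
        show "finite C" using vector_basis_finite[OF boundary_fanD(1)[OF fan C(1)]] .
        fix b assume b: "b \<in> C"
        have "representation C q b \<noteq> 0"
          using q boundary_fanD(1,2)[OF fan C(1)] b by (auto simp: generic_direction_def)
        then have "0 < representation C x b \<or> 0 \<le> representation C x b \<and> 0 < representation C q b"
          using C(2) b by (force simp: half_open_cone_def)
        then show "\<forall>\<^sub>F \<epsilon> in at_right 0. 0 < representation C x b + \<epsilon> * representation C q b"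
        proof (elim disjE conjE)
          assume p: "0 < representation C x b"
          then show ?thesis by (rule order_tendstoD(1)[OF to_rep])
        next
          assume *: "0 \<le> representation C x b" "0 < representation C q b"
          show ?thesis using eventually_at_right_less[of "0::real"]
            by eventually_elim (use * in \<open>auto intro: add_nonneg_pos mult_pos_pos\<close>)
        qed
      qed
      then show ?thesis
        by eventually_elim (simp add: basis_cone_interior_def linear_add[OF lin] linear_cmul[OF lin])
    qed
    have "\<forall>\<^sub>F \<epsilon> in at_right 0. x + \<epsilon> *\<^sub>R q \<in> basis_cone_interior B \<inter> basis_cone_interior B'"
      using ev[of B] ev[of B'] B B' by (simp add: eventually_conj_iff)
    then have "\<exists>\<epsilon>. x + \<epsilon> *\<^sub>R q \<in> basis_cone_interior B \<inter> basis_cone_interior B'"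
      by (rule eventually_happens'[OF trivial_limit_at_right_real])
    then have "basis_cone_interior B \<inter> basis_cone_interior B' \<noteq> {}" by blast
    then show "B = B'" using fan B B' unfolding boundary_fan_def by blast
  qed
qed

section \<open>Generating functions of lattice points\<close>

definition level_series :: "('a \<Rightarrow> real) \<Rightarrow> 'a set \<Rightarrow> int fps" where
  "level_series f S = Abs_fps (\<lambda>n. int (card {x \<in> S. f x = real n}))"

lemma finite_bounded_integer_points:
  fixes S :: "(real ^ 'd) set"
  assumes "bounded S"
  shows "finite (S \<inter> integer_points)"
proof -
  obtain m where m: "\<And>x. x \<in> S \<Longrightarrow> norm x \<le> m" using assms by (auto simp: bounded_iff)
  define I where "I = (of_int :: int \<Rightarrow> real) ` {- \<lceil>m\<rceil>..\<lceil>m\<rceil>}"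
  have "S \<inter> integer_points \<subseteq> (\<lambda>f. \<chi> i. f i) ` (UNIV \<rightarrow>\<^sub>E I)"
  proof
    fix x assume x: "x \<in> S \<inter> integer_points"
    have "x $ i \<in> I" for i
    proof -
      obtain z where z: "x $ i = of_int z" using x by (auto simp: integer_points_def elim: Ints_cases)
      have "\<bar>x $ i\<bar> \<le> m" using x m[of x] component_le_norm_cart[of x i] by auto
      then have "\<bar>of_int z\<bar> \<le> (of_int \<lceil>m\<rceil> :: real)" using z by linarith
      then have "\<bar>z\<bar> \<le> \<lceil>m\<rceil>" by linarith
      then show ?thesis unfolding I_def by (intro image_eqI[of _ _ z] z) auto
    qed
    then show "x \<in> (\<lambda>f. \<chi> i. f i) ` (UNIV \<rightarrow>\<^sub>E I)"
      by (intro image_eqI[of _ _ "\<lambda>i. x $ i"]) (auto simp: vec_eq_iff)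
  qed
  then show ?thesis
    by (rule finite_subset) (intro finite_imageI finite_PiE, auto simp: I_def)
qed

lemma integer_points_add: "x \<in> integer_points \<Longrightarrow> y \<in> integer_points \<Longrightarrow> x + y \<in> integer_points"
  by (auto simp: integer_points_def)

lemma integer_points_diff: "x \<in> integer_points \<Longrightarrow> y \<in> integer_points \<Longrightarrow> x - y \<in> integer_points"
  by (auto simp: integer_points_def)

lemma integer_points_sum:
  "(\<And>b. b \<in> B \<Longrightarrow> b \<in> integer_points) \<Longrightarrow> (\<Sum>b\<in>B. b) \<in> integer_points"
  by (auto simp: integer_points_def intro!: Ints_sum)

text \<open>These sets interpolate between the half-open fundamental parallelepiped (\<open>A = {}\<close>) and the
  half-open cone (\<open>A = B\<close>): the coordinates in \<open>A\<close> are not bounded above, the others range over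
  \<open>[0, 1)\<close> or \<open>(0, 1]\<close> according to the sign of the corresponding coordinate of \<open>q\<close>.\<close>

definition partial_cone :: "real ^ 'd \<Rightarrow> (real ^ 'd) set \<Rightarrow> (real ^ 'd) set \<Rightarrow> (real ^ 'd) set" where
  "partial_cone q B A = {x \<in> integer_points \<inter> half_open_cone q B.
     \<forall>b\<in>B - A. representation B x b \<le> 1 \<and> (0 < representation B q b \<longrightarrow> representation B x b < 1)}"

lemma finite_partial_cone_level:
  fixes B :: "(real ^ 'd) set"
  assumes vb: "vector_basis B" and k: "0 < (k::nat)"
  shows "finite {x \<in> partial_cone q B A. real k * interpolant (\<lambda>_. 1) B x = s}"
proof -
  have bound: "norm x \<le> (\<Sum>b\<in>B. s / real k * norm b)"
    if x: "x \<in> partial_cone q B A" "real k * interpolant (\<lambda>_. 1) B x = s" for x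
  proof -
    have nn: "0 \<le> representation B x b" if "b \<in> B" for b
      using x that by (auto simp: partial_cone_def half_open_cone_def)
    have sum: "(\<Sum>b\<in>B. representation B x b) = s / real k"
      using x(2) k by (simp add: interpolant_def field_simps)
    have le: "representation B x b \<le> s / real k" if "b \<in> B" for b
      unfolding sum[symmetric] using that nn vector_basis_finite[OF vb]
      by (intro member_le_sum) auto
    have "norm x = norm (\<Sum>b\<in>B. representation B x b *\<^sub>R b)"
      using representation_sum_eq[OF vb] by simp
    also have "\<dots> \<le> (\<Sum>b\<in>B. s / real k * norm b)"
    proof (rule sum_norm_le)
      show "norm (representation B x b *\<^sub>R b) \<le> s / real k * norm b" if "b \<in> B" for b
        using nn[OF that] mult_right_mono[OF le[OF that] norm_ge_zero[of b]] by simp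
    qed
    finally show ?thesis .
  qed
  then have "bounded {x \<in> partial_cone q B A. real k * interpolant (\<lambda>_. 1) B x = s}"
    by (intro boundedI[of _ "\<Sum>b\<in>B. s / real k * norm b"] bound) simp_all
  then have "finite ({x \<in> partial_cone q B A. real k * interpolant (\<lambda>_. 1) B x = s} \<inter> integer_points)"
    by (rule finite_bounded_integer_points)
  then show ?thesis by (rule rev_finite_subset) (auto simp: partial_cone_def)
qed

text \<open>Subtracting \<open>b\<close> from a point whose \<open>b\<close>-coordinate is too large for \<open>A\<close> gives a point of the
  larger set, so the larger set is the disjoint union of the smaller one and its own translate
  by \<open>b\<close>.\<close>

lemma level_series_partial_cone_insert:
  fixes B :: "(real ^ 'd) set"
  assumes vb: "vector_basis B" and BZ: "B \<subseteq> integer_points" and b: "b \<in> B" "b \<notin> A" and k: "0 < k"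
    and q: "representation B q b \<noteq> 0"
  defines "f \<equiv> \<lambda>x. real k * interpolant (\<lambda>_. 1) B x"
  shows "(1 - fps_X ^ k) * level_series f (partial_cone q B (insert b A)) =
    level_series f (partial_cone q B A)"
proof -
  let ?U = "partial_cone q B (insert b A)"
  note lin = representation_linear[OF vb]
  have rep_add: "representation B (x + b) b' = representation B x b' + (if b' = b then 1 else 0)" for x b'
    using linear_add[OF lin] representation_at_basis[OF vb b(1)] by simp
  have rep_diff: "representation B (x - b) b' = representation B x b' - (if b' = b then 1 else 0)" for x b'
    using linear_diff[OF lin] representation_at_basis[OF vb b(1)] by simp
  have f_add: "f (x + b) = f x + real k" for x
    unfolding f_def using linear_add[OF interpolant_linear[OF vb]] interpolant_at_basis[OF vb b(1)]
    by (simp add: algebra_simps)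
  have f_nonneg: "0 \<le> f x" if "x \<in> ?U" for x
    using that unfolding f_def interpolant_def
    by (auto simp: partial_cone_def half_open_cone_def intro!: mult_nonneg_nonneg sum_nonneg)
  have bZ: "b \<in> integer_points" using b BZ by blast
  have U: "?U = partial_cone q B A \<union> (\<lambda>x. x + b) ` ?U"
  proof (intro subset_antisym subsetI)
    fix x assume x: "x \<in> ?U"
    show "x \<in> partial_cone q B A \<union> (\<lambda>x. x + b) ` ?U"
    proof (cases "x \<in> partial_cone q B A")
      case False
      then obtain b' where b': "b' \<in> B - A"
        "\<not> (representation B x b' \<le> 1 \<and> (0 < representation B q b' \<longrightarrow> representation B x b' < 1))"
        using x by (auto simp: partial_cone_def)
      then have "b' = b" using x by (auto simp: partial_cone_def)
      then have large: "1 \<le> representation B x b \<and> (representation B q b < 0 \<longrightarrow> 1 < representation B x b)"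
        using b'(2) q by auto
      have "x - b \<in> ?U"
        using x large bZ unfolding partial_cone_def half_open_cone_def
        by (auto simp: rep_diff integer_points_diff)
      then show ?thesis by (auto intro!: image_eqI[of x _ "x - b"])
    qed simp
  next
    fix x assume "x \<in> partial_cone q B A \<union> (\<lambda>x. x + b) ` ?U"
    then show "x \<in> ?U"
    proof
      assume "x \<in> (\<lambda>x. x + b) ` ?U"
      then obtain y where y: "y \<in> ?U" "x = y + b" by blast
      then show "x \<in> ?U" using bZ unfolding partial_cone_def half_open_cone_def
        by (auto simp: rep_add integer_points_add add_nonneg_pos)
    qed (auto simp: partial_cone_def)
  qed
  have disj: "partial_cone q B A \<inter> (\<lambda>x. x + b) ` ?U = {}"
    using b q by (force simp: partial_cone_def half_open_cone_def rep_add)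
  have fin: "finite {x \<in> partial_cone q B A'. f x = s}" for A' s
    unfolding f_def by (rule finite_partial_cone_level[OF vb k])
  have "fps_nth (level_series f ?U) n = fps_nth (level_series f (partial_cone q B A)) n + fps_nth (fps_X ^ k * level_series f ?U) n"
    for n
  proof -
    define V where "V = {x \<in> (\<lambda>x. x + b) ` ?U. f x = real n}"
    have "{x \<in> ?U. f x = real n} = {x \<in> partial_cone q B A. f x = real n} \<union> V"
      unfolding V_def using U by blast
    moreover have "finite V" using calculation fin[of "insert b A" "real n"] by simp
    ultimately have "card {x \<in> ?U. f x = real n} = card {x \<in> partial_cone q B A. f x = real n} + card V"
      using fin disj by (simp, intro card_Un_disjoint) (auto simp: V_def)
    moreover have "int (card V) = fps_nth (fps_X ^ k * level_series f ?U) n"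
    proof -
      have V: "V = (\<lambda>x. x + b) ` {x \<in> ?U. f x + real k = real n}"
        unfolding V_def by (auto simp: f_add)
      have "card V = card {x \<in> ?U. f x + real k = real n}"
        unfolding V by (rule card_image) (auto simp: inj_on_def)
      moreover have "{x \<in> ?U. f x + real k = real n} = (if n < k then {} else {x \<in> ?U. f x = real (n - k)})"
        using f_nonneg by (force simp: of_nat_diff)
      ultimately show ?thesis
        by (simp add: fps_X_power_mult_nth level_series_def)
    qed
    ultimately show ?thesis by (simp add: level_series_def)
  qed
  then have "level_series f ?U = level_series f (partial_cone q B A) + fps_X ^ k * level_series f ?U"
    by (simp add: fps_eq_iff)
  then show ?thesis by (simp add: algebra_simps)
qed

lemma level_series_half_open_cone:
  fixes B :: "(real ^ 'd) set"
  assumes vb: "vector_basis B" and BZ: "B \<subseteq> integer_points" and k: "0 < k"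
    and q: "\<And>b. b \<in> B \<Longrightarrow> representation B q b \<noteq> 0"
  defines "f \<equiv> \<lambda>x. real k * interpolant (\<lambda>_. 1) B x"
  shows "(1 - fps_X ^ k) ^ CARD('d) * level_series f (integer_points \<inter> half_open_cone q B) =
    level_series f (partial_cone q B {})"
proof -
  have "(1 - fps_X ^ k) ^ card A * level_series f (partial_cone q B A) = level_series f (partial_cone q B {})"
    if "finite A" "A \<subseteq> B" for A
    using that
  proof (induction A rule: finite_induct)
    case (insert b A)
    then have step: "(1 - fps_X ^ k) * level_series f (partial_cone q B (insert b A)) =
        level_series f (partial_cone q B A)"
      unfolding f_def by (intro level_series_partial_cone_insert[OF vb BZ _ _ k q]) auto
    have "(1 - fps_X ^ k) ^ card (insert b A) * level_series f (partial_cone q B (insert b A)) =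
        (1 - fps_X ^ k) ^ card A * ((1 - fps_X ^ k) * level_series f (partial_cone q B (insert b A)))"
      unfolding card_insert_disjoint[OF insert.hyps] by (simp only: power_Suc ac_simps)
    also have "\<dots> = (1 - fps_X ^ k) ^ card A * level_series f (partial_cone q B A)"
      by (simp only: step)
    also have "\<dots> = level_series f (partial_cone q B {})"
      using insert.prems by (intro insert.IH) simp
    finally show ?case .
  qed simp
  from this[OF vector_basis_finite[OF vb] order_refl] show ?thesis
    unfolding vector_basis_card[OF vb] by (simp add: partial_cone_def Int_def)
qed

text \<open>The point reflection that maps the closed parallelepiped to itself exchanges the missing and the
  present facets, which is the passage from \<open>q\<close> to \<open>- q\<close>.\<close>

lemma parallelepiped_reflection:
  fixes B :: "(real ^ 'd) set"
  assumes vb: "vector_basis B" and BZ: "B \<subseteq> integer_points" and n: "n \<le> k * CARD('d)"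
    and q: "\<And>b. b \<in> B \<Longrightarrow> representation B q b \<noteq> 0"
  defines "f \<equiv> \<lambda>x. real k * interpolant (\<lambda>_. 1) B x"
  shows "fps_nth (level_series f (partial_cone q B {})) n =
    fps_nth (level_series f (partial_cone (- q) B {})) (k * CARD('d) - n)"
proof -
  define v where "v = (\<Sum>b\<in>B. b)"
  have vZ: "v \<in> integer_points" unfolding v_def using BZ by (intro integer_points_sum) auto
  note lin = representation_linear[OF vb]
  have rep_v: "representation B v b = 1" if "b \<in> B" for b
  proof -
    have "representation B v b = (\<Sum>b'\<in>B. if b = b' then 1 else 0)"
      unfolding v_def linear_sum[OF lin] by (rule sum.cong) (auto simp: representation_at_basis[OF vb])
    then show ?thesis using that vector_basis_finite[OF vb] by simp
  qed
  have f_v: "f v = real (k * CARD('d))"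
    by (simp add: f_def interpolant_def rep_v vector_basis_card[OF vb])
  have f_refl: "f (v - x) = real (k * CARD('d)) - f x" for x
    using linear_diff[OF interpolant_linear[OF vb], of "\<lambda>_. 1" v x] f_v
    by (simp add: f_def right_diff_distrib)
  have maps: "v - x \<in> partial_cone (- q') B {}"
    if x: "x \<in> partial_cone q' B {}" and q': "\<And>b. b \<in> B \<Longrightarrow> representation B q' b \<noteq> 0" for x q'
    using x vZ q' unfolding partial_cone_def half_open_cone_def
    by (auto simp: linear_diff[OF lin] linear_neg[OF lin] rep_v integer_points_diff)
  have "bij_betw (\<lambda>x. v - x) {x \<in> partial_cone q B {}. f x = real n}
      {x \<in> partial_cone (- q) B {}. f x = real (k * CARD('d) - n)}"
  proof (rule bij_betw_byWitness[where f' = "\<lambda>x. v - x"])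
    show "(\<lambda>x. v - x) ` {x \<in> partial_cone q B {}. f x = real n}
        \<subseteq> {x \<in> partial_cone (- q) B {}. f x = real (k * CARD('d) - n)}"
      using maps[of _ q] q n by (auto simp: f_refl of_nat_diff)
    show "(\<lambda>x. v - x) ` {x \<in> partial_cone (- q) B {}. f x = real (k * CARD('d) - n)}
        \<subseteq> {x \<in> partial_cone q B {}. f x = real n}"
      using maps[of _ "- q"] q n by (auto simp: f_refl of_nat_diff linear_neg[OF lin])
  qed auto
  then show ?thesis by (simp add: level_series_def bij_betw_same_card)
qed

lemma parallelepiped_level_bound:
  fixes B :: "(real ^ 'd) set"
  assumes vb: "vector_basis B" and n: "k * CARD('d) < n"
  shows "fps_nth (level_series (\<lambda>x. real k * interpolant (\<lambda>_. 1) B x) (partial_cone q B {})) n = 0"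
proof -
  have "real k * interpolant (\<lambda>_. 1) B x < real n" if x: "x \<in> partial_cone q B {}" for x
  proof -
    have "interpolant (\<lambda>_. 1) B x \<le> (\<Sum>b\<in>B. 1)"
      unfolding interpolant_def using x by (intro sum_mono) (auto simp: partial_cone_def)
    then have "real k * interpolant (\<lambda>_. 1) B x \<le> real k * CARD('d)"
      by (intro mult_left_mono) (auto simp: vector_basis_card[OF vb])
    also have "\<dots> < real n" using n by (metis of_nat_less_iff of_nat_mult)
    finally show ?thesis .
  qed
  then have "{x \<in> partial_cone q B {}. real k * interpolant (\<lambda>_. 1) B x = real n} = {}" by force
  then show ?thesis by (simp only: level_series_def fps_nth_Abs_fps card.empty of_nat_0)
qed

section \<open>Palindromic polynomials\<close>

lemma palindromic_of_symmetric_fps: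
  fixes f :: "int fps"
  assumes "fps_nth f 0 = 1" and sym: "\<And>n. n \<le> m \<Longrightarrow> fps_nth f n = fps_nth f (m - n)" and zero: "\<And>n. m < n \<Longrightarrow> fps_nth f n = 0"
  obtains p where "fps_of_poly p = f" "palindromic p"
proof -
  define p where "p = Abs_poly (\<lambda>n. fps_nth f n)"
  have c: "coeff p n = fps_nth f n" for n
    unfolding p_def by (subst coeff_Abs_poly[of m]) (auto simp: zero)
  have deg: "degree p = m"
  proof (rule antisym)
    show "degree p \<le> m" by (rule degree_le) (auto simp: c zero)
    show "m \<le> degree p" by (rule le_degree) (use assms(1) sym[of m] in \<open>simp add: c\<close>)
  qed
  have "coeff (reflect_poly p) n = coeff p n" for n
    using sym[of n] zero[of n] by (simp add: coeff_reflect_poly deg c)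
  then have "palindromic p" by (simp add: palindromic_def poly_eq_iff)
  moreover have "fps_of_poly p = f" by (simp add: fps_eq_iff c)
  ultimately show ?thesis using that by blast
qed

lemma palindromic_mult: "palindromic p \<Longrightarrow> palindromic q \<Longrightarrow> palindromic (p * q)"
  by (simp add: palindromic_def reflect_poly_mult)

section \<open>Polytopes whose gauge is integral at lattice points\<close>

text \<open>The integrality assumption says that passing from the dilation factor \<open>(n - 1) / k\<close> to \<open>n / k\<close>
  adds precisely the lattice points at level \<open>n\<close>, so that \<open>(1 - X) E\<close> is a sum of level series of
  half-open cones. Applying this to both \<open>q\<close> and \<open>- q\<close> gives two expressions for the same series,
  which the reflection of the parallelepipeds exchanges.\<close>

theorem palindromic_lattice_point_series:
  fixes W :: "(real ^ 'd) set" and k :: nat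
  assumes W: "finite W" "W \<subseteq> integer_points" "0 \<in> interior (convex hull W)" and k: "0 < k"
    and fan: "boundary_fan W F"
    and integral: "\<And>B x. B \<in> F \<Longrightarrow> x \<in> basis_cone B \<Longrightarrow> x \<in> integer_points
       \<Longrightarrow> real k * interpolant (\<lambda>_. 1) B x \<in> \<int>"
  defines "E \<equiv> Abs_fps (\<lambda>n. int (card (dilate (real n / real k) (convex hull W) \<inter> integer_points)))"
  shows "\<exists>h. fps_of_poly h = (1 - fps_X ^ k) ^ (CARD('d) + 1) * E \<and> palindromic h"
proof -
  define g where "g = (\<lambda>B x. real k * interpolant (\<lambda>_. 1) B (x :: real ^ 'd))"
  define L where "L = (\<lambda>n::nat. dilate (real n / real k) (convex hull W) \<inter> integer_points)"
  define N where "N = (\<lambda>q. \<Sum>B\<in>F. level_series (g B) (partial_cone q B {}))"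
  define K where "K = (1 - fps_X ^ k) ^ CARD('d) * ((1 - fps_X) * E)"
  have finF: "finite F" using fan by (simp add: boundary_fan_def)
  note vb = boundary_fanD(1)[OF fan]
  have BW: "B \<subseteq> W" if "B \<in> F" for B using boundary_fanD(2)[OF fan that] .
  have BZ: "B \<subseteq> integer_points" if "B \<in> F" for B using BW[OF that] W(2) by blast
  have zero: "0 \<in> convex hull W" using W(3) interior_subset by blast
  have half_sub: "half_open_cone q B \<subseteq> basis_cone B" for q B
    by (auto simp: half_open_cone_def basis_cone_def)
  have g_nonneg: "0 \<le> g B x" if "x \<in> basis_cone B" for B x
    using that unfolding g_def interpolant_def basis_cone_def
    by (auto intro!: mult_nonneg_nonneg sum_nonneg)
  have L_iff: "x \<in> L n \<longleftrightarrow> x \<in> integer_points \<and> g B x \<le> real n"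
    if "B \<in> F" "x \<in> basis_cone B" for x n B
    using mem_scaled_hull_iff[OF fan that(1) zero that(2), of "real n / real k"] k
    by (auto simp: L_def dilate_def g_def field_simps)
  have finL: "finite (L n)" for n
    unfolding L_def dilate_def using W(1)
    by (intro finite_bounded_integer_points bounded_scaling finite_imp_bounded_convex_hull)
  have L_mono: "L n \<subseteq> L (Suc n)" for n
  proof
    fix x assume x: "x \<in> L n"
    obtain B where B: "B \<in> F" "x \<in> basis_cone B" using fan unfolding boundary_fan_def by blast
    then show "x \<in> L (Suc n)" using x L_iff[OF B, of n] L_iff[OF B, of "Suc n"] by auto
  qed
  \<comment> \<open>Multiplying by \<open>1 - X\<close> leaves the lattice points that enter at level \<open>n\<close>, and the half-open
    cones partition them.\<close>
  have shell: "fps_nth ((1 - fps_X) * E) n = (\<Sum>B\<in>F. fps_nth (level_series (g B) (integer_points \<inter> half_open_cone q B)) n)"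
    if q: "generic_direction W q" for q n
  proof -
    define S where "S = (if n = 0 then L 0 else L n - L (n - 1))"
    define T where "T = (\<lambda>B. {x \<in> integer_points \<inter> half_open_cone q B. g B x = real n})"
    have S_iff: "x \<in> S \<longleftrightarrow> x \<in> integer_points \<and> g B x = real n"
      if B: "B \<in> F" "x \<in> half_open_cone q B" for B x
    proof (cases "x \<in> integer_points")
      case True
      have xB: "x \<in> basis_cone B" using B half_sub by blast
      obtain z where z: "g B x = of_int z" using integral[OF B(1) xB True] by (auto simp: g_def elim: Ints_cases)
      have "0 \<le> z" using g_nonneg[OF xB] z by simp
      have mem: "x \<in> L m \<longleftrightarrow> z \<le> int m" for m
        using True L_iff[OF B(1) xB, of m] z of_int_le_iff[of z "int m", where ?'a = real] by simp
      have "g B x = real n \<longleftrightarrow> z = int n"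
        using z of_int_eq_iff[of z "int n", where ?'a = real] by simp
      then show ?thesis
        using True \<open>0 \<le> z\<close> by (cases n) (auto simp: S_def mem)
    qed (auto simp: S_def L_def)
    have "S = (\<Union>B\<in>F. T B)"
    proof (intro subset_antisym subsetI)
      fix x assume x: "x \<in> S"
      obtain B where B: "B \<in> F" "x \<in> half_open_cone q B"
        using half_open_cone_partition[OF fan q, of x] by blast
      then show "x \<in> (\<Union>B\<in>F. T B)" using S_iff[OF B] x by (auto simp: T_def)
    next
      fix x assume "x \<in> (\<Union>B\<in>F. T B)"
      then obtain B where "B \<in> F" "x \<in> T B" by blast
      then show "x \<in> S" using S_iff[of B x] by (auto simp: T_def)
    qed
    moreover have "T B \<inter> T B' = {}" if "B \<in> F" "B' \<in> F" "B \<noteq> B'" for B B'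
      using half_open_cone_partition[OF fan q] that unfolding T_def by blast
    moreover have "finite S" using finL by (simp add: S_def)
    ultimately have "card S = (\<Sum>B\<in>F. card (T B))"
      using finF by (simp only:) (intro card_UN_disjoint, auto)
    moreover have "fps_nth ((1 - fps_X) * E) n = int (card S)"
    proof (cases n)
      case 0
      then show ?thesis by (simp add: S_def E_def L_def)
    next
      case (Suc m)
      have "int (card S) = int (card (L n)) - int (card (L m))"
        using Suc card_Diff_subset[OF finL L_mono, of m] card_mono[OF finL L_mono, of m]
        by (simp add: S_def of_nat_diff)
      then show ?thesis using Suc
        by (simp add: E_def L_def algebra_simps fps_X_mult_nth)
    qed
    ultimately show ?thesis by (simp add: level_series_def T_def)
  qed
  have K_eq: "K = N q" if q: "generic_direction W q" for q
  proof -
    have q': "representation B q b \<noteq> 0" if "B \<in> F" "b \<in> B" for B b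
      using q BW[OF that(1)] vb[OF that(1)] that by (auto simp: generic_direction_def)
    have "(1 - fps_X) * E = (\<Sum>B\<in>F. level_series (g B) (integer_points \<inter> half_open_cone q B))"
      using shell[OF q] by (simp add: fps_eq_iff fps_sum_nth)
    then have "K = (\<Sum>B\<in>F. (1 - fps_X ^ k) ^ CARD('d) *
        level_series (g B) (integer_points \<inter> half_open_cone q B))"
      by (simp add: K_def sum_distrib_left)
    also have "\<dots> = N q"
      unfolding N_def g_def
      by (intro sum.cong refl level_series_half_open_cone vb BZ k q')
    finally show ?thesis .
  qed
  obtain q where q: "generic_direction W q" using generic_direction_exists[OF W(1)] by blast
  have q': "representation B q b \<noteq> 0" if "B \<in> F" "b \<in> B" for B b
    using q BW[OF that(1)] vb[OF that(1)] that by (auto simp: generic_direction_def)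
  have "fps_nth K n = fps_nth K (k * CARD('d) - n)" if n: "n \<le> k * CARD('d)" for n
  proof -
    have "fps_nth (N q) n = fps_nth (N (- q)) (k * CARD('d) - n)"
      unfolding N_def fps_sum_nth g_def
      by (intro sum.cong refl parallelepiped_reflection vb BZ n q')
    then show ?thesis using K_eq[OF q] K_eq[OF generic_direction_uminus[OF q]] by simp
  qed
  moreover have "fps_nth K n = 0" if n: "k * CARD('d) < n" for n
    unfolding K_eq[OF q] N_def fps_sum_nth g_def
    by (intro sum.neutral ballI parallelepiped_level_bound vb n)
  moreover have "fps_nth K 0 = 1"
  proof -
    have "(\<lambda>x. 0) ` (convex hull W) = {0}" using zero by auto
    then have "L 0 = {0}" by (auto simp: L_def dilate_def integer_points_def)
    then have "fps_nth E 0 = 1" by (simp add: E_def L_def)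
    then show ?thesis using k by (simp add: K_def fps_nth_power_0 fps_mult_nth_0 zero_power)
  qed
  ultimately obtain p where p: "fps_of_poly p = K" "palindromic p"
    using palindromic_of_symmetric_fps by metis
  obtain s :: "int poly" where s: "fps_of_poly s = (\<Sum>i<k. fps_X ^ i)" "palindromic s"
  proof (rule palindromic_of_symmetric_fps)
    have nth: "fps_nth (\<Sum>i<k. fps_X ^ i) n = (if n < k then 1 else 0 :: int)" for n
      by (simp add: fps_sum_nth fps_X_power_nth)
    show "fps_nth (\<Sum>i<k. fps_X ^ i) 0 = (1 :: int)" using k by (simp add: nth)
    show "fps_nth (\<Sum>i<k. fps_X ^ i) n = (fps_nth (\<Sum>i<k. fps_X ^ i) (k - 1 - n) :: int)" if "n \<le> k - 1" for n
      using that k by (auto simp: nth)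
    show "fps_nth (\<Sum>i<k. fps_X ^ i) n = (0 :: int)" if "k - 1 < n" for n using that by (simp add: nth)
  qed
  have "(1 - fps_X ^ k) = (1 - fps_X) * (\<Sum>i<k. fps_X ^ i :: int fps)"
    using sum_gp_basic[of "fps_X :: int fps" "k - 1"] k
    by (simp add: lessThan_Suc_atMost[symmetric])
  then have "fps_of_poly (p * s) = (1 - fps_X ^ k) ^ (CARD('d) + 1) * E"
    by (simp add: fps_of_poly_mult p s K_def ac_simps)
  then show ?thesis using palindromic_mult[OF p(2) s(2)] by blast
qed

section \<open>Integral facet descriptions and the codenominator\<close>

definition real_vec :: "int ^ 'd \<Rightarrow> real ^ 'd" where
  "real_vec a = (\<chi> j. real_of_int (a $ j))"

lemma row_halfspace_eq: "row_halfspace a \<beta> = {x. real_vec a \<bullet> x \<le> real_of_int \<beta>}"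
  by (simp add: row_halfspace_def real_vec_def inner_vec_def)

lemma det_in_Ints:
  fixes A :: "real ^ 'n ^ 'n"
  assumes "\<And>i j. A $ i $ j \<in> \<int>"
  shows "det A \<in> \<int>"
  unfolding det_def using assms by (intro Ints_sum Ints_mult Ints_prod) auto

text \<open>Cramer's rule for the linear system that says that the functional is \<open>1\<close> on \<open>B\<close>.\<close>

lemma coordinate_sum_rational:
  fixes B :: "(real ^ 'd) set"
  assumes vb: "vector_basis B" and BZ: "B \<subseteq> integer_points"
  obtains a :: "int ^ 'd" and m :: int where "0 < m"
    "\<And>x. real_of_int m * interpolant (\<lambda>_. 1) B x = real_vec a \<bullet> x"
proof -
  obtain z where z: "\<And>v. interpolant (\<lambda>_. 1) B v = z \<bullet> v"
    using linear_functional_as_inner[OF interpolant_linear[OF vb]] by blast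
  have "card (UNIV :: 'd set) = card B" using vector_basis_card[OF vb] by simp
  then obtain f where f: "bij_betw f (UNIV :: 'd set) B"
    using finite_same_card_bij[OF finite vector_basis_finite[OF vb]] by blast
  have fB: "f i \<in> B" for i using f by (auto simp: bij_betw_def)
  define A where "A = (\<chi> i. f i)"
  have Az: "A *v z = (\<chi> i. 1)"
    using interpolant_at_basis[OF vb fB, of "\<lambda>_. 1"]
    by (simp add: A_def matrix_vector_mult_def vec_eq_iff z inner_vec_def mult.commute)
  have "x = 0" if x: "A *v x = 0" for x
  proof -
    have orth: "f i \<bullet> x = 0" for i
      using x by (simp add: A_def matrix_vector_mult_def vec_eq_iff inner_vec_def)
    have "B \<subseteq> {v. v \<bullet> x = 0}"
    proof
      fix b assume "b \<in> B"
      then obtain i where "b = f i" using f by (auto simp: bij_betw_def)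
      then show "b \<in> {v. v \<bullet> x = 0}" by (simp add: orth)
    qed
    then have "span B \<subseteq> {v. v \<bullet> x = 0}"
      by (rule span_minimal) (auto simp: subspace_def inner_add_left)
    then have "x \<in> {v. v \<bullet> x = 0}" using vb unfolding vector_basis_def by blast
    then show ?thesis by simp
  qed
  then have "invertible A" unfolding invertible_left_inverse matrix_left_invertible_ker by blast
  then have D: "det A \<noteq> 0" by (simp add: invertible_det_nz)
  have ent: "A $ i $ j \<in> \<int>" for i j using fB BZ by (auto simp: A_def integer_points_def)
  have "det A \<in> \<int>" using ent by (rule det_in_Ints)
  then obtain D' where D': "det A = of_int D'" by (auto elim: Ints_cases)
  have "\<exists>t. z $ j * \<bar>det A\<bar> = of_int t" for j
  proof -
    let ?M = "\<chi> i l. if l = j then (\<chi> i. 1) $ i else A $ i $ l"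
    have "z = (\<chi> j. det (\<chi> i l. if l = j then (\<chi> i. 1) $ i else A $ i $ l) / det A)"
      using cramer[OF D, of z "\<chi> i. 1"] Az by simp
    then have "z $ j = det ?M / det A" by (metis (no_types, lifting) vec_lambda_beta)
    then have "z $ j * \<bar>det A\<bar> = sgn (det A) * det ?M" using D by (simp add: abs_sgn)
    also have "\<dots> \<in> \<int>"
      using ent by (intro Ints_mult det_in_Ints) (auto simp: sgn_if)
    finally show ?thesis by (auto elim: Ints_cases)
  qed
  then obtain t where t: "\<And>j. z $ j * \<bar>det A\<bar> = of_int (t j)" by metis
  show ?thesis
  proof (rule that[of "\<bar>D'\<bar>" "\<chi> j. t j"])
    show "0 < \<bar>D'\<bar>" using D D' by auto
    show "real_of_int \<bar>D'\<bar> * interpolant (\<lambda>_. 1) B x = real_vec (\<chi> j. t j) \<bullet> x" for x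
      by (simp add: z inner_vec_def real_vec_def sum_distrib_left D' mult_ac flip: t)
  qed
qed

lemma row_halfspace_primitive:
  fixes a :: "int ^ 'd"
  assumes "0 < \<beta>"
  obtains a' \<beta>' where "Gcd (insert \<beta>' (range (\<lambda>j. a' $ j))) = 1"
    "row_halfspace a' \<beta>' = row_halfspace a \<beta>"
proof -
  define g where "g = Gcd (insert \<beta> (range (\<lambda>j. a $ j)))"
  have "g \<noteq> 0" using assms by (auto simp: g_def)
  moreover have "0 \<le> g" by (simp add: g_def)
  ultimately have g: "0 < g" by simp
  have dvd: "g dvd \<beta>" "g dvd a $ j" for j unfolding g_def by (rule Gcd_dvd, simp)+
  define a' where "a' = (\<chi> j. a $ j div g)"
  define \<beta>' where "\<beta>' = \<beta> div g"
  have mult: "g * \<beta>' = \<beta>" "g * a' $ j = a $ j" for j using dvd by (auto simp: a'_def \<beta>'_def)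
  define G where "G = Gcd (insert \<beta>' (range (\<lambda>j. a' $ j)))"
  have "((*) g) ` insert \<beta>' (range (\<lambda>j. a' $ j)) = insert \<beta> (range (\<lambda>j. a $ j))"
    by (simp add: image_image mult)
  then have "normalize (g * G) = g"
    unfolding G_def Gcd_mult[symmetric] by (simp only: g_def)
  moreover have "0 \<le> G" unfolding G_def by simp
  ultimately have "G = 1" using g by (simp add: abs_mult)
  then have "Gcd (insert \<beta>' (range (\<lambda>j. a' $ j))) = 1" by (simp only: G_def)
  moreover have "row_halfspace a' \<beta>' = row_halfspace a \<beta>"
  proof -
    have "real_vec a = real_of_int g *\<^sub>R real_vec a'"
      by (simp add: real_vec_def vec_eq_iff flip: mult(2))
    moreover have "real_of_int \<beta> = real_of_int g * real_of_int \<beta>'" by (simp flip: mult(1))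
    ultimately show ?thesis using g by (simp add: row_halfspace_eq)
  qed
  ultimately show ?thesis by (rule that)
qed

text \<open>A point that satisfies the inequality belonging to its own cone of the fan lies in \<open>P\<close>, so the
  finitely many inequalities of the fan cut out \<open>P\<close>; a minimal subfamily that still does so is
  irredundant.\<close>

lemma irredundant_description_exists:
  fixes P :: "(real ^ 'd) set"
  assumes P: "lattice_polytope P" and int: "0 \<in> interior P"
  obtains n A b where "irredundant_description P n A b"
proof -
  obtain S where S: "finite S" "S \<subseteq> integer_points" "P = convex hull S"
    using P by (auto simp: lattice_polytope_def)
  obtain F where fan: "boundary_fan S F" using boundary_fan_exists S int by metis
  have finF: "finite F" using fan by (simp add: boundary_fan_def)
  have zero: "0 \<in> convex hull S" using int S interior_subset by blast
  have P_eq: "P = (\<Inter>B\<in>F. {x. interpolant (\<lambda>_. 1) B x \<le> 1})"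
  proof (intro subset_antisym subsetI)
    fix x assume "x \<in> P"
    then show "x \<in> (\<Inter>B\<in>F. {x. interpolant (\<lambda>_. 1) B x \<le> 1})"
      using fan_interpolant_le_one[OF fan] S by auto
  next
    fix x assume x: "x \<in> (\<Inter>B\<in>F. {x. interpolant (\<lambda>_. 1) B x \<le> 1})"
    obtain B where B: "B \<in> F" "x \<in> basis_cone B" using fan unfolding boundary_fan_def by blast
    then show "x \<in> P" using mem_scaled_hull_iff[OF fan B(1) zero B(2), of 1] x S by auto
  qed
  have "\<exists>p. Gcd (insert (snd p) (range (\<lambda>j. fst p $ j))) = 1 \<and>
      row_halfspace (fst p) (snd p) = {x. interpolant (\<lambda>_. 1) B x \<le> 1}" if B: "B \<in> F" for B
  proof -
    have "B \<subseteq> integer_points" using boundary_fanD(2)[OF fan B] S(2) by (rule subset_trans)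
    then obtain a :: "int ^ 'd" and m :: int
      where am: "0 < m" "\<And>x. real_of_int m * interpolant (\<lambda>_. 1) B x = real_vec a \<bullet> x"
      by (rule coordinate_sum_rational[OF boundary_fanD(1)[OF fan B]]) (rule that)
    obtain a' m' where "Gcd (insert m' (range (\<lambda>j. a' $ j))) = 1" "row_halfspace a' m' = row_halfspace a m"
      by (rule row_halfspace_primitive[OF am(1), of a])
    moreover have "row_halfspace a m = {x. interpolant (\<lambda>_. 1) B x \<le> 1}"
      using am(1) by (simp add: row_halfspace_eq flip: am(2))
    ultimately show ?thesis by (intro exI[of _ "(a', m')"]) simp
  qed
  then obtain p where p: "\<And>B. B \<in> F \<Longrightarrow> Gcd (insert (snd (p B)) (range (\<lambda>j. fst (p B) $ j))) = 1"
    "\<And>B. B \<in> F \<Longrightarrow> row_halfspace (fst (p B)) (snd (p B)) = {x. interpolant (\<lambda>_. 1) B x \<le> 1}"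
    by metis
  define H where "H = (\<lambda>r :: (int ^ 'd) \<times> int. row_halfspace (fst r) (snd r))"
  define descr where "descr = {R. R \<subseteq> p ` F \<and> P = (\<Inter>r\<in>R. H r)}"
  have "finite descr" unfolding descr_def using finF by simp
  moreover have "p ` F \<in> descr" using p(2) by (auto simp: descr_def H_def P_eq)
  ultimately obtain R where R: "R \<in> descr" and min: "\<And>R'. R' \<in> descr \<Longrightarrow> R' \<subseteq> R \<Longrightarrow> R' = R"
    using finite_has_minimal[of descr] by blast
  have RF: "R \<subseteq> p ` F" and PR: "P = (\<Inter>r\<in>R. H r)" using R by (auto simp: descr_def)
  have finR: "finite R" using RF finF finite_surj by blast
  obtain h where h: "bij_betw h {..<card R} R"
    using ex_bij_betw_nat_finite[OF finR] by (auto simp: lessThan_atLeast0)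
  have hR: "h ` {..<card R} = R" using h by (simp add: bij_betw_def)
  have "irredundant_description P (card R) (\<lambda>i. fst (h i)) (\<lambda>i. snd (h i))"
    unfolding irredundant_description_def
  proof (intro conjI allI impI)
    show "P = (\<Inter>i\<in>{..<card R}. row_halfspace (fst (h i)) (snd (h i)))"
    proof -
      have "(\<Inter>i\<in>{..<card R}. row_halfspace (fst (h i)) (snd (h i))) = (\<Inter>r\<in>h ` {..<card R}. H r)"
        by (simp only: H_def image_image)
      then show ?thesis by (simp only: hR PR)
    qed
    fix j assume j: "j < card R"
    have img: "h ` ({..<card R} - {j}) = R - {h j}"
      using inj_on_image_set_diff[of h "{..<card R}" "{..<card R}" "{j}"] h j
      by (simp add: bij_betw_def)
    have "(\<Inter>i\<in>{..<card R} - {j}. row_halfspace (fst (h i)) (snd (h i))) =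
        (\<Inter>r\<in>h ` ({..<card R} - {j}). H r)"
      by (simp only: H_def image_image)
    also have "\<dots> = (\<Inter>r\<in>R - {h j}. H r)" by (simp only: img)
    finally have "(\<Inter>i\<in>{..<card R} - {j}. row_halfspace (fst (h i)) (snd (h i))) = (\<Inter>r\<in>R - {h j}. H r)" .
    moreover have "(\<Inter>r\<in>R - {h j}. H r) \<noteq> P"
    proof
      assume "(\<Inter>r\<in>R - {h j}. H r) = P"
      then have "R - {h j} \<in> descr" using RF by (auto simp: descr_def)
      then have "R - {h j} = R" using min by blast
      then show False using hR j by blast
    qed
    ultimately show "(\<Inter>i\<in>{..<card R} - {j}. row_halfspace (fst (h i)) (snd (h i))) \<noteq> P" by simp
  next
    fix i assume "i < card R"
    then have "h i \<in> p ` F" using hR RF by blast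
    then show "Gcd (insert (snd (h i)) (range (\<lambda>j. fst (h i) $ j))) = 1" using p(1) by auto
  qed
  then show ?thesis by (rule that)
qed

text \<open>A right-hand side \<open>0\<close> would make the row vanish, since a neighbourhood of the origin satisfies the
  inequality; but the zero row has greatest common divisor \<open>0\<close>.\<close>

lemma irredundant_description_rhs_pos:
  fixes P :: "(real ^ 'd) set"
  assumes desc: "irredundant_description P n A b" and int: "0 \<in> interior P" and i: "i < n"
  shows "0 < b i"
proof -
  have P: "P \<subseteq> row_halfspace (A i) (b i)" using desc i by (auto simp: irredundant_description_def)
  obtain e where e: "0 < e" "cball 0 e \<subseteq> P" using int mem_interior_cball by blast
  have "0 \<in> cball (0 :: real ^ 'd) e" using e(1) by simp
  then have "0 \<in> row_halfspace (A i) (b i)" using P e(2) by blast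
  then have "0 \<le> b i" by (simp add: row_halfspace_eq)
  moreover have "b i \<noteq> 0"
  proof
    assume b0: "b i = 0"
    define a where "a = real_vec (A i)"
    have na: "0 < norm a + 1" by (simp add: add_nonneg_pos)
    have "e * norm a \<le> e * (norm a + 1)" using e(1) by simp
    then have "e / (norm a + 1) * norm a \<le> e"
      unfolding times_divide_eq_left by (rule pos_divide_le_eq[OF na, THEN iffD2])
    then have "(e / (norm a + 1)) *\<^sub>R a \<in> cball 0 e"
      using e(1) by simp
    then have "(e / (norm a + 1)) *\<^sub>R a \<in> row_halfspace (A i) (b i)" using e(2) P by blast
    then have "(e / (norm a + 1)) * (a \<bullet> a) \<le> 0" by (simp add: row_halfspace_eq b0 flip: a_def)
    moreover have "0 < e / (norm a + 1)" using e(1) na by simp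
    ultimately have "a \<bullet> a \<le> 0" by (simp only: mult_le_0_iff) auto
    then have "a \<bullet> a = 0" using inner_ge_zero[of a] by linarith
    then have "a = 0" by simp
    then have "A i $ j = 0" for j by (simp add: a_def real_vec_def vec_eq_iff)
    then have "Gcd (insert (b i) (range (\<lambda>j. A i $ j))) = 0" using b0 by (simp add: Gcd_0_iff)
    moreover have "Gcd (insert (b i) (range (\<lambda>j. A i $ j))) = 1"
      using desc i unfolding irredundant_description_def by blast
    ultimately show False by (metis zero_neq_one)
  qed
  ultimately show ?thesis by simp
qed

text \<open>Irredundance of a row gives a boundary point \<open>y\<close> at which only this row is tight. Any other
  description has a tight row there too, and near \<open>y\<close> both half-spaces must agree, so the two rows
  are proportional; primitivity makes them equal.\<close>

lemma irredundant_description_rows_subset: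
  fixes P :: "(real ^ 'd) set"
  assumes desc: "irredundant_description P n A b" and desc': "irredundant_description P n' A' b'"
    and int: "0 \<in> interior P" and j: "j < n"
  obtains i where "i < n'" "A' i = A j" "b' i = b j"
proof -
  note pos = irredundant_description_rhs_pos[OF desc int]
  note pos' = irredundant_description_rhs_pos[OF desc' int]
  have mem: "x \<in> P \<longleftrightarrow> (\<forall>i<n. real_vec (A i) \<bullet> x \<le> real_of_int (b i))" for x
    using desc by (auto simp: irredundant_description_def row_halfspace_eq)
  have mem': "x \<in> P \<longleftrightarrow> (\<forall>i<n'. real_vec (A' i) \<bullet> x \<le> real_of_int (b' i))" for x
    using desc' by (auto simp: irredundant_description_def row_halfspace_eq)
  define a where "a = real_vec (A j)"
  have "(\<Inter>i\<in>{..<n} - {j}. row_halfspace (A i) (b i)) \<noteq> P"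
    using desc j unfolding irredundant_description_def by blast
  moreover have "P \<subseteq> (\<Inter>i\<in>{..<n} - {j}. row_halfspace (A i) (b i))"
    using desc by (auto simp: irredundant_description_def)
  ultimately obtain y0 where y0: "y0 \<notin> P"
    "\<And>i. i < n \<Longrightarrow> i \<noteq> j \<Longrightarrow> real_vec (A i) \<bullet> y0 \<le> real_of_int (b i)"
    by (auto simp: row_halfspace_eq)
  then have big: "real_of_int (b j) < a \<bullet> y0" using mem j by (force simp: a_def not_le)
  \<comment> \<open>Shrinking the violating point until row \<open>j\<close> becomes tight makes all other rows strict.\<close>
  define s where "s = real_of_int (b j) / (a \<bullet> y0)"
  have bj: "0 < real_of_int (b j)" using pos[OF j] by simp
  have s: "0 < s" "s < 1" using big bj by (auto simp: s_def)
  define y where "y = s *\<^sub>R y0"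
  have tight: "a \<bullet> y = real_of_int (b j)" using big bj by (simp add: y_def s_def)
  have strict: "real_vec (A i) \<bullet> y < real_of_int (b i)" if "i < n" "i \<noteq> j" for i
  proof -
    have "real_vec (A i) \<bullet> y \<le> s * real_of_int (b i)"
      using y0(2)[OF that] s(1) by (simp add: y_def)
    also have "\<dots> < real_of_int (b i)" using s(2) pos[OF that(1)] by simp
    finally show ?thesis .
  qed
  have yP: "y \<in> P" unfolding mem
  proof (intro allI impI)
    show "real_vec (A i) \<bullet> y \<le> real_of_int (b i)" if "i < n" for i
      using strict[OF that] tight by (cases "i = j") (auto simp: a_def)
  qed
  have "\<exists>i<n'. real_vec (A' i) \<bullet> y = real_of_int (b' i)"
  proof (rule ccontr)
    assume none: "\<not> (\<exists>i<n'. real_vec (A' i) \<bullet> y = real_of_int (b' i))"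
    have lt: "real_vec (A' i) \<bullet> y < real_of_int (b' i)" if "i < n'" for i
    proof -
      have "real_vec (A' i) \<bullet> y \<le> real_of_int (b' i)" using yP mem' that by blast
      moreover have "real_vec (A' i) \<bullet> y \<noteq> real_of_int (b' i)" using none that by blast
      ultimately show ?thesis by simp
    qed
    obtain \<delta> where \<delta>: "0 < \<delta>"
      "\<And>i. i \<in> {..<n'} \<Longrightarrow> \<delta> * \<bar>real_vec (A' i) \<bullet> y\<bar> \<le> real_of_int (b' i) - real_vec (A' i) \<bullet> y"
      by (rule common_small_factor[of "{..<n'}" "\<lambda>i. real_of_int (b' i) - real_vec (A' i) \<bullet> y"
            "\<lambda>i. real_vec (A' i) \<bullet> y"]) (use lt in auto)
    have "(1 + \<delta>) *\<^sub>R y \<in> P" unfolding mem'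
    proof (intro allI impI)
      fix i assume "i < n'"
      moreover have "\<delta> * (real_vec (A' i) \<bullet> y) \<le> \<delta> * \<bar>real_vec (A' i) \<bullet> y\<bar>"
        using \<delta>(1) by (intro mult_left_mono) auto
      ultimately show "real_vec (A' i) \<bullet> ((1 + \<delta>) *\<^sub>R y) \<le> real_of_int (b' i)"
        using \<delta>(2)[of i] by (simp add: algebra_simps)
    qed
    then have "(1 + \<delta>) * real_of_int (b j) \<le> real_of_int (b j)"
      using mem j tight by (auto simp: a_def)
    then show False using \<delta>(1) bj by (simp add: algebra_simps mult_le_0_iff)
  qed
  then obtain i where i: "i < n'" and tight': "real_vec (A' i) \<bullet> y = real_of_int (b' i)" by blast
  define a' where "a' = real_vec (A' i)"
  have half: "a' \<bullet> v \<le> 0" if v: "a \<bullet> v \<le> 0" for v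
  proof -
    obtain \<delta> where \<delta>: "0 < \<delta>"
      "\<And>l. l \<in> {..<n} - {j} \<Longrightarrow> \<delta> * \<bar>real_vec (A l) \<bullet> v\<bar> \<le> real_of_int (b l) - real_vec (A l) \<bullet> y"
      by (rule common_small_factor[of "{..<n} - {j}" "\<lambda>i. real_of_int (b i) - real_vec (A i) \<bullet> y"
            "\<lambda>i. real_vec (A i) \<bullet> v"]) (use strict in auto)
    have "y + \<delta> *\<^sub>R v \<in> P" unfolding mem
    proof (intro allI impI)
      fix l assume l: "l < n"
      show "real_vec (A l) \<bullet> (y + \<delta> *\<^sub>R v) \<le> real_of_int (b l)"
      proof (cases "l = j")
        case True
        have "\<delta> * (a \<bullet> v) \<le> 0" using v \<delta>(1) by (simp add: mult_le_0_iff)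
        then show ?thesis using True tight by (simp add: inner_add_right a_def)
      next
        case False
        have "\<delta> * (real_vec (A l) \<bullet> v) \<le> \<delta> * \<bar>real_vec (A l) \<bullet> v\<bar>"
          using \<delta>(1) by (intro mult_left_mono) auto
        then show ?thesis using \<delta>(2)[of l] l False by (simp add: inner_add_right)
      qed
    qed
    then have "a' \<bullet> (y + \<delta> *\<^sub>R v) \<le> real_of_int (b' i)" using mem' i by (simp add: a'_def)
    then have "\<delta> * (a' \<bullet> v) \<le> 0" using tight' by (simp add: inner_add_right a'_def)
    then show ?thesis using \<delta>(1) by (simp add: mult_le_0_iff)
  qed
  have "a \<bullet> a \<noteq> 0" using tight bj by auto
  \<comment> \<open>The component \<open>v\<close> of \<open>a'\<close> orthogonal to \<open>a\<close> satisfies \<open>a' \<bullet> v \<le> 0\<close>, so it vanishes.\<close>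
  define l where "l = (a' \<bullet> a) / (a \<bullet> a)"
  define v where "v = a' - l *\<^sub>R a"
  have av: "a \<bullet> v = 0"
    using \<open>a \<bullet> a \<noteq> 0\<close> by (simp add: v_def l_def inner_diff_right inner_commute)
  have "v \<bullet> v = a' \<bullet> v - l * (a \<bullet> v)" by (simp add: v_def inner_diff_left)
  then have "v \<bullet> v \<le> 0" using av half[of v] by simp
  then have "v \<bullet> v = 0" using inner_ge_zero[of v] by linarith
  then have "v = 0" by simp
  then have "a' = l *\<^sub>R a" by (simp add: v_def)
  then have "real_of_int (b' i) = l * real_of_int (b j)" using tight tight' by (simp add: a'_def)
  then have proportional: "real_of_int (b j) *\<^sub>R a' = real_of_int (b' i) *\<^sub>R a"
    using \<open>a' = l *\<^sub>R a\<close> by (simp add: mult.commute)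
  have cross: "b j * A' i $ c = b' i * A j $ c" for c
  proof -
    have "real_of_int (b j) * real_of_int (A' i $ c) = real_of_int (b' i) * real_of_int (A j $ c)"
      using arg_cong[OF proportional, of "\<lambda>u. u $ c"] by (simp add: a_def a'_def real_vec_def)
    then show ?thesis by (metis of_int_eq_iff of_int_mult)
  qed
  have gcd1: "Gcd (insert (b j) (range (\<lambda>c. A j $ c))) = 1"
    and gcd2: "Gcd (insert (b' i) (range (\<lambda>c. A' i $ c))) = 1"
    using desc desc' i j unfolding irredundant_description_def by blast+
  have "((*) (b' i)) ` insert (b j) (range (\<lambda>c. A j $ c)) = (*) (b j) ` insert (b' i) (range (\<lambda>c. A' i $ c))"
    by (simp add: image_image cross mult.commute)
  then have "normalize (b' i * 1) = normalize (b j * 1)"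
    using Gcd_mult[of "b' i" "insert (b j) (range (\<lambda>c. A j $ c))"]
      Gcd_mult[of "b j" "insert (b' i) (range (\<lambda>c. A' i $ c))"] gcd1 gcd2 by simp
  then have beq: "b' i = b j" using pos[OF j] pos'[OF i] by simp
  then have "A' i = A j" using cross pos[OF j] by (simp add: vec_eq_iff)
  then show ?thesis using that i beq by blast
qed

text \<open>Two irredundant descriptions have the same set of rows, so the description operator in the
  definition of the codenominator denotes the least common multiple for any one of them.\<close>

lemma codenominator_description:
  fixes P :: "(real ^ 'd) set"
  assumes P: "lattice_polytope P" and int: "0 \<in> interior P"
  obtains n A b where "irredundant_description P n A b" "0 < codenominator P"
    "\<And>i. i < n \<Longrightarrow> 0 < b i" "\<And>i. i < n \<Longrightarrow> b i dvd int (codenominator P)"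
proof -
  define M where "M = (\<lambda>n (b :: nat \<Rightarrow> int). {nat \<bar>b i\<bar> | i. i < n \<and> b i \<noteq> 0})"
  obtain n A b where desc: "irredundant_description P n A b"
    by (rule irredundant_description_exists[OF P int])
  have sub: "M n1 b1 \<subseteq> M n2 b2"
    if d1: "irredundant_description P n1 A1 b1" and d2: "irredundant_description P n2 A2 b2"
    for n1 n2 A1 A2 b1 b2
  proof
    fix x assume "x \<in> M n1 b1"
    then obtain j where j: "j < n1" "b1 j \<noteq> 0" "x = nat \<bar>b1 j\<bar>" by (auto simp: M_def)
    obtain i where "i < n2" "A2 i = A1 j" "b2 i = b1 j"
      by (rule irredundant_description_rows_subset[OF d1 d2 int j(1)])
    then show "x \<in> M n2 b2" unfolding M_def using j by (intro CollectI exI[of _ i]) simp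
  qed
  have "codenominator P = Lcm (M n b)"
    unfolding codenominator_def
  proof (rule the_equality)
    show "\<exists>n' A b'. irredundant_description P n' A b' \<and>
        Lcm (M n b) = Lcm {nat \<bar>b' i\<bar> | i. i < n' \<and> b' i \<noteq> 0}"
      using desc unfolding M_def by blast
    fix r assume "\<exists>n A b. irredundant_description P n A b \<and> r = Lcm {nat \<bar>b i\<bar> | i. i < n \<and> b i \<noteq> 0}"
    then obtain n' A' b' where d': "irredundant_description P n' A' b'" and "r = Lcm (M n' b')"
      unfolding M_def by blast
    then show "r = Lcm (M n b)" using sub[OF desc d'] sub[OF d' desc] by simp
  qed
  note pos = irredundant_description_rhs_pos[OF desc int]
  have M_eq: "M n b = (\<lambda>i. nat \<bar>b i\<bar>) ` {..<n}" using pos by (force simp: M_def)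
  have "0 < codenominator P"
  proof -
    have "0 \<notin> M n b" by (auto simp: M_def)
    moreover have "finite (M n b)" by (simp add: M_eq)
    ultimately have "Lcm (M n b) \<noteq> 0" by (simp add: Lcm_0_iff del: Lcm_0_iff_nat)
    then show ?thesis using \<open>codenominator P = Lcm (M n b)\<close> by (metis neq0_conv)
  qed
  moreover have "b i dvd int (codenominator P)" if "i < n" for i
  proof -
    have "nat \<bar>b i\<bar> dvd codenominator P"
      unfolding \<open>codenominator P = Lcm (M n b)\<close> using that by (intro dvd_Lcm) (simp add: M_eq)
    then have "int (nat \<bar>b i\<bar>) dvd int (codenominator P)" by (simp only: int_dvd_int_iff)
    then show ?thesis by simp
  qed
  ultimately show ?thesis using that desc pos by blast
qed

section \<open>Integrality of the gauge and palindromicity\<close>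

lemma dilate_dilate: "dilate s (dilate t P) = dilate (s * t) P"
  by (simp add: dilate_def image_image)

lemma dilate_zero: "P \<noteq> {} \<Longrightarrow> dilate 0 P = {0}"
  by (auto simp: dilate_def)

theorem corollary26:
  fixes P :: "(real ^ 'd) set" and r k :: nat
  assumes "lattice_polytope P"
    and "aff_dim P = int CARD('d)"
    and "0 \<in> interior P"
    and "r = codenominator P"
    and "k = denominator (dilate (1 / real r) P)"
  shows "\<exists>h. fps_of_poly h = hstar_rat P k \<and> palindromic h"
proof -
  obtain n A b where desc: "irredundant_description P n A b" and r: "0 < r"
    and b_pos: "\<And>i. i < n \<Longrightarrow> 0 < b i" and b_dvd: "\<And>i. i < n \<Longrightarrow> b i dvd int r"
    using codenominator_description[OF assms(1,3)] assms(4) by metis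
  have "0 < r \<and> lattice_polytope (dilate (real r) (dilate (1 / real r) P))"
    using r assms(1) by (simp add: dilate_dilate) (simp add: dilate_def)
  then have k_prop: "0 < k \<and> lattice_polytope (dilate (real k) (dilate (1 / real r) P))"
    unfolding assms(5) denominator_def by (rule LeastI)
  then have k: "0 < k" by blast
  obtain W where W: "finite W" "W \<subseteq> integer_points" and W_eq: "convex hull W = dilate (real k / real r) P"
    using k_prop by (auto simp: lattice_polytope_def dilate_dilate)
  have dil: "dilate s (convex hull W) = dilate (s * real k / real r) P" for s
    by (simp add: W_eq dilate_dilate)
  have "linear (\<lambda>x :: real ^ 'd. (real k / real r) *\<^sub>R x)" by (intro linear_scaleR)
  moreover have "inj (\<lambda>x :: real ^ 'd. (real k / real r) *\<^sub>R x)"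
    using k r by (auto simp: inj_on_def)
  ultimately have "interior (convex hull W) = (\<lambda>x. (real k / real r) *\<^sub>R x) ` interior P"
    unfolding W_eq dilate_def by (rule interior_injective_linear_image)
  then have int: "0 \<in> interior (convex hull W)"
    using assms(3) by (auto intro!: image_eqI[of _ _ 0])
  then have zero: "0 \<in> convex hull W" using interior_subset by blast
  obtain F where fan: "boundary_fan W F" by (rule boundary_fan_exists[OF W(1) int])
  \<comment> \<open>The gauge \<open>\<sigma>\<close> of \<open>x\<close> is the least \<open>s\<close> such that \<open>s k\<close> bounds the integers \<open>z i\<close>, up to the
    constraint \<open>0 \<le> s\<close>; so \<open>k \<sigma>\<close> does not exceed its own floor. The criterion below is for
    positive \<open>s\<close>, therefore both bounds are approached through an arbitrary \<open>e > 0\<close>.\<close>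
  have integral: "real k * interpolant (\<lambda>_. 1) B x \<in> \<int>"
    if B: "B \<in> F" and x: "x \<in> basis_cone B" "x \<in> integer_points" for B x
  proof -
    define \<sigma> where "\<sigma> = interpolant (\<lambda>_. 1) B x"
    have "0 \<le> \<sigma>" using x(1) by (auto simp: \<sigma>_def interpolant_def basis_cone_def intro!: sum_nonneg)
    define z where "z = (\<lambda>i. (int r div b i) * (\<Sum>j\<in>UNIV. A i $ j * \<lfloor>x $ j\<rfloor>))"
    have row: "real_vec (A i) \<bullet> x * real r = real_of_int (z i) * real_of_int (b i)" if i: "i < n" for i
    proof -
      have "x $ j = real_of_int \<lfloor>x $ j\<rfloor>" for j
        using x(2) by (simp add: integer_points_def)
      then have "real_vec (A i) \<bullet> x = real_of_int (\<Sum>j\<in>UNIV. A i $ j * \<lfloor>x $ j\<rfloor>)"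
        by (simp add: inner_vec_def real_vec_def)
      moreover have "real r = real_of_int (int r div b i) * real_of_int (b i)"
        using b_dvd[OF i] by (metis dvd_div_mult_self of_int_mult of_int_of_nat_eq)
      ultimately show ?thesis by (simp add: z_def)
    qed
    have iff: "\<sigma> \<le> s \<longleftrightarrow> (\<forall>i<n. real_of_int (z i) \<le> s * real k)" if s: "0 < s" for s
    proof -
      have t: "0 < s * real k / real r" using s k r by simp
      have "\<sigma> \<le> s \<longleftrightarrow> x \<in> dilate (s * real k / real r) P"
        using mem_scaled_hull_iff[OF fan B zero x(1), of s] s
        by (simp add: \<sigma>_def dilate_def flip: dil[unfolded dilate_def])
      also have "\<dots> \<longleftrightarrow> (1 / (s * real k / real r)) *\<^sub>R x \<in> P"
        using t by (auto simp: dilate_def intro!: image_eqI)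
      also have "\<dots> \<longleftrightarrow> (\<forall>i<n. (real_vec (A i) \<bullet> x) * real r \<le> s * real k * real_of_int (b i))"
        using desc s k r by (auto simp: irredundant_description_def row_halfspace_eq field_simps)
      also have "\<dots> \<longleftrightarrow> (\<forall>i<n. real_of_int (z i) \<le> s * real k)"
        using b_pos by (auto simp: row)
      finally show ?thesis .
    qed
    have z_le: "z i \<le> \<lfloor>real k * \<sigma>\<rfloor>" if i: "i < n" for i
    proof -
      have "real_of_int (z i) \<le> real k * \<sigma> + e" if e: "0 < e" for e
      proof -
        have "0 < \<sigma> + e / real k" "\<sigma> \<le> \<sigma> + e / real k"
          using \<open>0 \<le> \<sigma>\<close> e k by (simp_all add: add_nonneg_pos)
        then have "real_of_int (z i) \<le> (\<sigma> + e / real k) * real k" using iff i by blast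
        also have "\<dots> = real k * \<sigma> + e" using k by (simp add: field_simps)
        finally show ?thesis .
      qed
      then have "real_of_int (z i) \<le> real k * \<sigma>" by (rule field_le_epsilon)
      then show ?thesis by (simp add: le_floor_iff)
    qed
    have "0 \<le> \<lfloor>real k * \<sigma>\<rfloor>" using \<open>0 \<le> \<sigma>\<close> by simp
    have "real k * \<sigma> \<le> real_of_int \<lfloor>real k * \<sigma>\<rfloor> + e" if e: "0 < e" for e
    proof -
      define s where "s = (real_of_int \<lfloor>real k * \<sigma>\<rfloor> + e) / real k"
      have sk: "s * real k = real_of_int \<lfloor>real k * \<sigma>\<rfloor> + e" using k by (simp add: s_def)
      have "0 < s" using \<open>0 \<le> \<lfloor>real k * \<sigma>\<rfloor>\<close> e k by (simp add: s_def add_nonneg_pos)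
      moreover have "real_of_int (z i) \<le> s * real k" if "i < n" for i
        using z_le[OF that] e unfolding sk by linarith
      ultimately have "\<sigma> \<le> s" using iff by blast
      then show ?thesis using sk k by (metis mult.commute mult_left_mono of_nat_0_le_iff)
    qed
    then have "real k * \<sigma> \<le> real_of_int \<lfloor>real k * \<sigma>\<rfloor>" by (rule field_le_epsilon)
    then have "real k * \<sigma> = real_of_int \<lfloor>real k * \<sigma>\<rfloor>" by linarith
    then show ?thesis unfolding \<sigma>_def by (metis Ints_of_int)
  qed
  have "Ehr_rat P = Abs_fps (\<lambda>n. int (card (dilate (real n / real k) (convex hull W) \<inter> integer_points)))"
  proof (rule fps_ext)
    fix n
    show "fps_nth (Ehr_rat P) n =
        fps_nth (Abs_fps (\<lambda>n. int (card (dilate (real n / real k) (convex hull W) \<inter> integer_points)))) n"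
    proof (cases "n = 0")
      case True
      have "dilate 0 (convex hull W) = {0}" using zero by (intro dilate_zero) auto
      then have "dilate 0 (convex hull W) \<inter> integer_points = {0}" by (auto simp: integer_points_def)
      then show ?thesis using True by (simp add: Ehr_rat_def)
    next
      case False
      have "dilate (real n / real k) (convex hull W) = dilate (real n / real r) P"
        using k by (simp add: dil)
      then show ?thesis using False by (simp add: Ehr_rat_def ehr_rat_def assms(4))
    qed
  qed
  then show ?thesis
    using palindromic_lattice_point_series[OF W int k fan integral] by (simp add: hstar_rat_def)
qed

end
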